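(* Let $n\ge4$ be even and let $s=(1,n)(2,n-1)\cdots(\frac n2,\frac n2+1)$ and $r=(1,2,\dots,n)$ in $D_n\subset S_n$. Let $\chi(sr)$ be the trace of the representation of $sr$ on $\overline{FK}_{C_n}(n)$. Then $$[\chi(sr)](q)=\sum_{k=0}^{\lfloor\frac{\frac n2-1}{2}\rfloor}\binom{\frac n2-1-k}{k}q^{2k},$$ and, in terms of $q$-Fibonacci polynomials, $$[\chi(sr)](q)=F_{\frac n2-1}(q^2).$$
   Context: Let $F$ be a field and $n>3$. $\overline{FK}_{C_n}(n)$ is the quotient of the Fomin-Kirillov algebra $FK(n)$ by the ideal generated by the $x_{ij}$ for which $\{i,j\}$ is not an edge of the $n$-cycle $C_n$ (vertices $1,\dots,n$, edges $\overline{12},\overline{23},\dots,\overline{n-1,n},\overline{1n}$). Explicitly, it is the associative unital $F$-algebra on generators $x_{1n}=-x_{n1}$ and $x_{m,m+1}=-x_{m+1,m}$ ($1\le m\le n-1$), that is, the free associative algebra on the $n$ letters $x_{12},x_{23},\dots,x_{n-1,n},x_{1n}$ modulo the two-sided ideal generated by the relations - $x_{m,m+1}^2=0$ for $1\le m\le n-1$, and $x_{1n}^2=0$; - $x_{m,m+1}x_{m+1,m+2}=0$ and $x_{m+1,m+2}x_{m,m+1}=0$ for $1\le m\le n-2$; - $x_{n-1,n}x_{1n}=0$, $x_{1n}x_{n-1,n}=0$, $x_{12}x_{1n}=0$, $x_{1n}x_{12}=0$; - $x_{m,m+1}x_{l,l+1}-x_{l,l+1}x_{m,m+1}=0$ for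 $1\le m\le l-2$, $3\le l\le n-1$; - $x_{m,m+1}x_{1n}-x_{1n}x_{m,m+1}=0$ for $2\le m\le n-2$. The algebra is graded by usual (total) degree, each generator having degree 1. The dihedral group $D_n=\langle r,s\mid s^2=r^n=(rs)^2=1\rangle$ is realized in $S_n$ as the symmetry group of the $n$-cycle, with $r=(1\,2\,\cdots\,n)$ and $s$ the permutation $i\mapsto n+1-i$; permutations are composed right to left, so $sr=(n)(1,n-1)(2,n-2)\cdots(\frac n2-1,\frac n2+1)(\frac n2)$. The group acts on $\overline{FK}_{C_n}(n)$ by degree-preserving algebra automorphisms determined by $\sigma x_{ij}=x_{\sigma(i)\sigma(j)}$ if $\sigma(i)<\sigma(j)$ and $\sigma x_{ij}=-x_{\sigma(j)\sigma(i)}$ otherwise (extended multiplicatively to monomials and linearly). $[\chi(\sigma)](q)=\sum_{d\ge0}\operatorname{tr}\big(\sigma\,|\,\overline{FK}^{(d)}_{C_n}(n)\big)q^d$ is the graded trace (total degree decomposition), where $\overline{FK}^{(d)}_{C_n}(n)$ is the degree $d$ component. The $q$-Fibonacci polynomials are $F_m(q)=\sum_{k=0}^{\lfloor m/2\rfloor}\binom{m-k}{k}q^k$ for $m\ge0$. *)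

theory Defs
  imports
    "HOL-Algebra.QuotRing"
    "HOL-Algebra.Module"
    "HOL-Library.Poly_Mapping"
    "HOL-Library.FuncSet"
    "HOL-Computational_Algebra.Polynomial_FPS"
    "HOL-Combinatorics.Cycles"
begin

section \<open>Free associative algebras\<close>

text \<open>Words form a monoid under concatenation, so that the finitely supported functions
  \<open>'x list \<Rightarrow>\<^sub>0 'a\<close>, with the convolution product of Poly_Mapping, are the noncommutative
  polynomials over \<open>'a\<close> in letters from \<open>'x\<close>.\<close>

instantiation list :: (type) monoid_add
begin

definition zero_list :: "'a list" where "zero_list = []"

definition plus_list :: "'a list \<Rightarrow> 'a list \<Rightarrow> 'a list" where "plus_list = (@)"

instance by standard (simp_all add: zero_list_def plus_list_def)

end

definition fa_const :: "'a::field \<Rightarrow> ('x list \<Rightarrow>\<^sub>0 'a)" where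
  "fa_const c = Poly_Mapping.single [] c"

definition free_algebra :: "'x set \<Rightarrow> ('a::field, 'x list \<Rightarrow>\<^sub>0 'a) module" where
  "free_algebra X =
    \<lparr>carrier = {p. \<forall>w\<in>Poly_Mapping.keys p. set w \<subseteq> X},
     monoid.mult = (*), one = 1, zero = 0, add = (+),
     module.smult = (\<lambda>c p. fa_const c * p)\<rparr>"

lemma free_algebra_simps [simp]:
  "carrier (free_algebra X) = {p. \<forall>w\<in>Poly_Mapping.keys p. set w \<subseteq> X}"
  "p \<otimes>\<^bsub>free_algebra X\<^esub> q = p * q" "\<one>\<^bsub>free_algebra X\<^esub> = 1"
  "\<zero>\<^bsub>free_algebra X\<^esub> = 0" "p \<oplus>\<^bsub>free_algebra X\<^esub> q = p + q"
  "c \<odot>\<^bsub>free_algebra X\<^esub> p = fa_const c * p"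
  by (simp_all add: free_algebra_def)

lemma ring_free_algebra: "ring (free_algebra X :: ('a::field, 'x list \<Rightarrow>\<^sub>0 'a) module)"
proof -
  let ?C = "carrier (free_algebra X :: ('a, 'x list \<Rightarrow>\<^sub>0 'a) module)"
  have times: "p * q \<in> ?C" if "p \<in> ?C" "q \<in> ?C" for p q
  proof -
    have "set w \<subseteq> X" if w: "w \<in> Poly_Mapping.keys (p * q)" for w
    proof -
      obtain u v where "w = u @ v" "u \<in> Poly_Mapping.keys p" "v \<in> Poly_Mapping.keys q"
        using keys_mult[of p q] w by (auto simp: plus_list_def)
      with \<open>p \<in> ?C\<close> \<open>q \<in> ?C\<close> show ?thesis by simp
    qed
    then show ?thesis by simp
  qed
  have plus: "p + q \<in> ?C" if "p \<in> ?C" "q \<in> ?C" for p q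
    using that Poly_Mapping.keys_add[of p q] unfolding free_algebra_simps by blast
  have uminus: "\<exists>q\<in>?C. q + p = 0" if "p \<in> ?C" for p
    using that by (intro bexI[of _ "- p"]) auto
  show ?thesis
  proof (rule ringI)
    show "abelian_group (free_algebra X :: ('a, 'x list \<Rightarrow>\<^sub>0 'a) module)"
      by (rule abelian_groupI; (unfold free_algebra_simps(2-))?)
        (erule (1) plus, simp, rule add.assoc, rule add.commute, simp, erule uminus)
    show "Group.monoid (free_algebra X :: ('a, 'x list \<Rightarrow>\<^sub>0 'a) module)"
      by (rule monoidI; (unfold free_algebra_simps(2-))?)
        (erule (1) times, simp add: zero_list_def, rule mult.assoc, simp, simp)
  qed (simp_all only: free_algebra_simps distrib_left distrib_right)
qed


section \<open>Quotient algebras and traces\<close>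

definition quotient_algebra ::
    "('a::field, 'v) module \<Rightarrow> 'v set \<Rightarrow> ('a, 'v set) module" where
  "quotient_algebra A I =
    \<lparr>carrier = carrier (A Quot I), monoid.mult = monoid.mult (A Quot I), one = one (A Quot I),
     zero = zero (A Quot I), add = add (A Quot I),
     module.smult = (\<lambda>c P. \<Union>p\<in>P. I +>\<^bsub>A\<^esub> (c \<odot>\<^bsub>A\<^esub> p))\<rparr>"

text \<open>The map induced on cosets by a map \<open>f\<close> that preserves the ideal \<open>I\<close>.\<close>

definition induced_map ::
    "('a::field, 'v) module \<Rightarrow> 'v set \<Rightarrow> ('v \<Rightarrow> 'v) \<Rightarrow> 'v set \<Rightarrow> 'v set" where
  "induced_map A I f P = (\<Union>p\<in>P. I +>\<^bsub>A\<^esub> f p)"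

text \<open>\<open>is_expansion M B c v\<close>: \<open>c\<close> is a coefficient family on \<open>B\<close> (normalised outside \<open>B\<close>) with
  \<open>v = \<Sum>b\<in>B. c b b\<close>.\<close>

definition is_expansion ::
    "('a::field, 'v) module \<Rightarrow> 'v set \<Rightarrow> ('v \<Rightarrow> 'a) \<Rightarrow> 'v \<Rightarrow> bool" where
  "is_expansion M B c v \<longleftrightarrow> c \<in> extensional B \<and> v = (\<Oplus>\<^bsub>M\<^esub>b\<in>B. c b \<odot>\<^bsub>M\<^esub> b)"

definition is_finite_basis :: "('a::field, 'v) module \<Rightarrow> 'v set \<Rightarrow> 'v set \<Rightarrow> bool" where
  "is_finite_basis M V B \<longleftrightarrow> finite B \<and> B \<subseteq> V \<and> (\<forall>v\<in>V. \<exists>!c. is_expansion M B c v)"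

definition coordinates :: "('a::field, 'v) module \<Rightarrow> 'v set \<Rightarrow> 'v \<Rightarrow> 'v \<Rightarrow> 'a" where
  "coordinates M B v = (THE c. is_expansion M B c v)"

text \<open>The trace of an endomorphism \<open>f\<close> of a finite-dimensional subspace \<open>V\<close> of \<open>M\<close>.\<close>

definition trace_on :: "('a::field, 'v) module \<Rightarrow> 'v set \<Rightarrow> ('v \<Rightarrow> 'v) \<Rightarrow> 'a" where
  "trace_on M V f =
    (let B = (SOME B. is_finite_basis M V B) in \<Sum>b\<in>B. coordinates M B (f b) b)"


section \<open>The quotient of the Fomin-Kirillov algebra attached to the \<open>n\<close>-cycle\<close>

text \<open>The letter \<open>(i, j)\<close> with \<open>i < j\<close> stands for the generator \<open>x\<^sub>i\<^sub>j\<close>; \<open>gen i j\<close> is \<open>x\<^sub>i\<^sub>j\<close> for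
  all \<open>i \<noteq> j\<close>, with the convention \<open>x\<^sub>i\<^sub>j = - x\<^sub>j\<^sub>i\<close>.\<close>

definition cycle_letters :: "nat \<Rightarrow> (nat \<times> nat) set" where
  "cycle_letters n = {(m, m + 1) | m. 1 \<le> m \<and> m \<le> n - 1} \<union> {(1, n)}"

definition gen :: "nat \<Rightarrow> nat \<Rightarrow> ((nat \<times> nat) list \<Rightarrow>\<^sub>0 'a::field)" where
  "gen i j = (if i < j then Poly_Mapping.single [(i, j)] 1 else - Poly_Mapping.single [(j, i)] 1)"

definition fk_relations :: "nat \<Rightarrow> ((nat \<times> nat) list \<Rightarrow>\<^sub>0 'a::field) set" where
  "fk_relations n =
     {gen m (m + 1) * gen m (m + 1) | m. 1 \<le> m \<and> m \<le> n - 1} \<union> {gen 1 n * gen 1 n}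
   \<union> {gen m (m + 1) * gen (m + 1) (m + 2) | m. 1 \<le> m \<and> m \<le> n - 2}
   \<union> {gen (m + 1) (m + 2) * gen m (m + 1) | m. 1 \<le> m \<and> m \<le> n - 2}
   \<union> {gen (n - 1) n * gen 1 n, gen 1 n * gen (n - 1) n, gen 1 2 * gen 1 n, gen 1 n * gen 1 2}
   \<union> {gen m (m + 1) * gen l (l + 1) - gen l (l + 1) * gen m (m + 1) | m l.
        1 \<le> m \<and> m \<le> l - 2 \<and> 3 \<le> l \<and> l \<le> n - 1}
   \<union> {gen m (m + 1) * gen 1 n - gen 1 n * gen m (m + 1) | m. 2 \<le> m \<and> m \<le> n - 2}"

definition fk_free :: "nat \<Rightarrow> ('a::field, (nat \<times> nat) list \<Rightarrow>\<^sub>0 'a) module" where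
  "fk_free n = free_algebra (cycle_letters n)"

definition fk_ideal :: "nat \<Rightarrow> ((nat \<times> nat) list \<Rightarrow>\<^sub>0 'a::field) set" where
  "fk_ideal n = Idl\<^bsub>fk_free n\<^esub> (fk_relations n)"

definition fk_cycle :: "nat \<Rightarrow> ('a::field, ((nat \<times> nat) list \<Rightarrow>\<^sub>0 'a) set) module" where
  "fk_cycle n = quotient_algebra (fk_free n) (fk_ideal n)"

definition fk_component :: "nat \<Rightarrow> nat \<Rightarrow> ((nat \<times> nat) list \<Rightarrow>\<^sub>0 'a::field) set set" where
  "fk_component n d =
    {fk_ideal n +>\<^bsub>fk_free n\<^esub> p | p.
       p \<in> carrier (fk_free n) \<and> (\<forall>w\<in>Poly_Mapping.keys p. length w = d)}"


section \<open>The dihedral action and its graded character\<close>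

definition rotation :: "nat \<Rightarrow> nat \<Rightarrow> nat" where
  "rotation n = cycle_of_list [1..<n + 1]"

definition reflection :: "nat \<Rightarrow> nat \<Rightarrow> nat" where
  "reflection n i = (if 1 \<le> i \<and> i \<le> n then n + 1 - i else i)"

text \<open>The algebra endomorphism with \<open>gen i j \<mapsto> gen (\<sigma> i) (\<sigma> j)\<close>; the sign for \<open>\<sigma> i > \<sigma> j\<close> comes
  from \<open>gen\<close>.\<close>

definition free_action ::
    "(nat \<Rightarrow> nat) \<Rightarrow> ((nat \<times> nat) list \<Rightarrow>\<^sub>0 'a::field) \<Rightarrow> ((nat \<times> nat) list \<Rightarrow>\<^sub>0 'a)" where
  "free_action \<sigma> p =
    (\<Sum>w\<in>Poly_Mapping.keys p.
       fa_const (Poly_Mapping.lookup p w) * prod_list (map (\<lambda>(i, j). gen (\<sigma> i) (\<sigma> j)) w))"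

definition fk_action ::
    "nat \<Rightarrow> (nat \<Rightarrow> nat) \<Rightarrow> ((nat \<times> nat) list \<Rightarrow>\<^sub>0 'a::field) set \<Rightarrow> ((nat \<times> nat) list \<Rightarrow>\<^sub>0 'a) set" where
  "fk_action n \<sigma> = induced_map (fk_free n) (fk_ideal n) (free_action \<sigma>)"

definition graded_trace :: "nat \<Rightarrow> (nat \<Rightarrow> nat) \<Rightarrow> 'a::field fps" where
  "graded_trace n \<sigma> = Abs_fps (\<lambda>d. trace_on (fk_cycle n) (fk_component n d) (fk_action n \<sigma>))"


section \<open>q-Fibonacci polynomials\<close>

definition q_fibonacci :: "nat \<Rightarrow> 'a::comm_semiring_1 poly" where
  "q_fibonacci m = (\<Sum>k = 0..m div 2. monom (of_nat ((m - k) choose k)) k)"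

end

theory Submission
  imports Defs "HOL-Combinatorics.Multiset_Permutations"
begin

text \<open>The defining relations say that two edges of the cycle annihilate each other when they share
  a vertex (or coincide) and commute otherwise. A monomial therefore vanishes unless its letters are
  distinct and form a matching, and then it depends only on the matching: the matchings with \<open>d\<close>
  edges give a basis of the component of degree \<open>d\<close>. That they span is a rewriting argument. That
  they are independent is seen through explicit functionals on the free algebra: for a matching \<open>S\<close>,
  add up the coefficients of all words that list \<open>S\<close>. The common kernel of these functionals is an
  ideal containing the relations, so it is the defining ideal (\<open>mem_I_iff\<close>).

  A vertex permutation that maps the cycle to itself permutes these basis vectors up to sign, so its
  trace in degree \<open>d\<close> is the signed number of invariant matchings with \<open>d\<close> edges
  (\<open>trace_signed_permutation\<close>). As the trace is defined through an arbitrary basis, this uses its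
  independence of the basis (\<open>trace_on_eq\<close>).

  For \<open>n = 2 h\<close>, \<open>sr\<close> reflects the cycle through the vertices \<open>h\<close> and \<open>n\<close>. The two edges at either
  of these vertices are exchanged and meet, so they lie in no invariant matching. Removing them
  leaves two paths with \<open>h - 2\<close> edges each, which the reflection exchanges. An invariant matching is
  thus a \<open>k\<close>-edge matching of one path together with its mirror image; it has degree \<open>2 k\<close>, and its
  \<open>2 k\<close> signs \<open>-1\<close> multiply to 1. A path with \<open>h - 2\<close> edges has \<open>(h - 1 - k) choose k\<close> matchings with
  \<open>k\<close> edges (\<open>card_sparse_subsets\<close>).\<close>

section \<open>Traces in coordinates\<close>

text \<open>The cosets of an ideal do not form a type with vector space operations, so the
  subspace \<open>V\<close> is presented by its coordinates: the functionals \<open>\<psi> s\<close> separate the points of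
  \<open>V\<close> and are dual to the vectors \<open>e s\<close>. Every vector space law that the trace computation
  needs then follows from the same law in the field.\<close>

locale coordinate_space =
  fixes M :: "('a::field, 'v) module" and V :: "'v set"
    and S :: "'s set" and \<psi> :: "'s \<Rightarrow> 'v \<Rightarrow> 'a" and e :: "'s \<Rightarrow> 'v"
  assumes abelian_monoid: "abelian_monoid M"
    and subset_carrier: "V \<subseteq> carrier M"
    and zero_mem: "\<zero>\<^bsub>M\<^esub> \<in> V"
    and add_closed: "u \<in> V \<Longrightarrow> v \<in> V \<Longrightarrow> u \<oplus>\<^bsub>M\<^esub> v \<in> V"
    and smult_closed: "v \<in> V \<Longrightarrow> c \<odot>\<^bsub>M\<^esub> v \<in> V"
    and coord_add: "s \<in> S \<Longrightarrow> u \<in> V \<Longrightarrow> v \<in> V \<Longrightarrow> \<psi> s (u \<oplus>\<^bsub>M\<^esub> v) = \<psi> s u + \<psi> s v"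
    and coord_smult: "s \<in> S \<Longrightarrow> v \<in> V \<Longrightarrow> \<psi> s (c \<odot>\<^bsub>M\<^esub> v) = c * \<psi> s v"
    and coord_inj: "u \<in> V \<Longrightarrow> v \<in> V \<Longrightarrow> (\<And>s. s \<in> S \<Longrightarrow> \<psi> s u = \<psi> s v) \<Longrightarrow> u = v"
    and finite_index: "finite S"
    and vec_closed: "s \<in> S \<Longrightarrow> e s \<in> V"
    and coord_vec: "s \<in> S \<Longrightarrow> t \<in> S \<Longrightarrow> \<psi> s (e t) = (if s = t then 1 else 0)"
begin

definition linear_on :: "('v \<Rightarrow> 'a) \<Rightarrow> bool" where
  "linear_on f \<longleftrightarrow> (\<forall>u\<in>V. \<forall>v\<in>V. f (u \<oplus>\<^bsub>M\<^esub> v) = f u + f v) \<and> (\<forall>c. \<forall>v\<in>V. f (c \<odot>\<^bsub>M\<^esub> v) = c * f v)"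

lemma linear_on_coord: "s \<in> S \<Longrightarrow> linear_on (\<psi> s)"
  by (simp add: linear_on_def coord_add coord_smult)

lemma linear_on_comp:
  assumes "linear_on f" "\<And>v. v \<in> V \<Longrightarrow> g v \<in> V"
    and "\<And>u v. u \<in> V \<Longrightarrow> v \<in> V \<Longrightarrow> g (u \<oplus>\<^bsub>M\<^esub> v) = g u \<oplus>\<^bsub>M\<^esub> g v"
    and "\<And>c v. v \<in> V \<Longrightarrow> g (c \<odot>\<^bsub>M\<^esub> v) = c \<odot>\<^bsub>M\<^esub> g v"
  shows "linear_on (\<lambda>v. f (g v))"
  using assms by (simp add: linear_on_def)

lemma linear_on_zero: "linear_on f \<Longrightarrow> f \<zero>\<^bsub>M\<^esub> = 0"
proof -
  interpret abelian_monoid M by (rule abelian_monoid)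
  assume "linear_on f"
  then have "f (\<zero>\<^bsub>M\<^esub> \<oplus>\<^bsub>M\<^esub> \<zero>\<^bsub>M\<^esub>) = f \<zero>\<^bsub>M\<^esub> + f \<zero>\<^bsub>M\<^esub>"
    unfolding linear_on_def using zero_mem by blast
  then have "f \<zero>\<^bsub>M\<^esub> = f \<zero>\<^bsub>M\<^esub> + f \<zero>\<^bsub>M\<^esub>" by simp
  then show ?thesis using add_cancel_right_right by blast
qed

text \<open>The finite sum in \<open>M\<close> is meaningful only while all partial sums stay in its carrier;
  therefore closure in \<open>V\<close> and compatibility with a functional are proved in one induction.\<close>

lemma combination:
  assumes "finite B" and h: "\<And>b. b \<in> B \<Longrightarrow> h b \<in> V"
  shows combination_closed: "(\<Oplus>\<^bsub>M\<^esub>b\<in>B. c b \<odot>\<^bsub>M\<^esub> h b) \<in> V"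
    and linear_on_combination:
      "linear_on f \<Longrightarrow> f (\<Oplus>\<^bsub>M\<^esub>b\<in>B. c b \<odot>\<^bsub>M\<^esub> h b) = (\<Sum>b\<in>B. c b * f (h b))"
proof -
  interpret abelian_monoid M by (rule abelian_monoid)
  have main: "(\<Oplus>\<^bsub>M\<^esub>b\<in>B. c b \<odot>\<^bsub>M\<^esub> h b) \<in> V \<and>
      (linear_on f \<longrightarrow> f (\<Oplus>\<^bsub>M\<^esub>b\<in>B. c b \<odot>\<^bsub>M\<^esub> h b) = (\<Sum>b\<in>B. c b * f (h b)))" for f
    using assms
  proof (induction B rule: finite_induct)
    case empty
    then show ?case by (simp add: zero_mem linear_on_zero)
  next
    case (insert x B)
    have cl: "c b \<odot>\<^bsub>M\<^esub> h b \<in> V" if "b \<in> insert x B" for b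
      using insert.prems that by (blast intro: smult_closed)
    have IH: "(\<Oplus>\<^bsub>M\<^esub>b\<in>B. c b \<odot>\<^bsub>M\<^esub> h b) \<in> V"
      "linear_on f \<Longrightarrow> f (\<Oplus>\<^bsub>M\<^esub>b\<in>B. c b \<odot>\<^bsub>M\<^esub> h b) = (\<Sum>b\<in>B. c b * f (h b))"
      using insert by auto
    have "(\<Oplus>\<^bsub>M\<^esub>b\<in>insert x B. c b \<odot>\<^bsub>M\<^esub> h b)
        = c x \<odot>\<^bsub>M\<^esub> h x \<oplus>\<^bsub>M\<^esub> (\<Oplus>\<^bsub>M\<^esub>b\<in>B. c b \<odot>\<^bsub>M\<^esub> h b)"
      using insert.hyps cl subset_carrier by (intro finsum_insert) blast+
    moreover have "f (c x \<odot>\<^bsub>M\<^esub> h x \<oplus>\<^bsub>M\<^esub> (\<Oplus>\<^bsub>M\<^esub>b\<in>B. c b \<odot>\<^bsub>M\<^esub> h b))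
        = c x * f (h x) + f (\<Oplus>\<^bsub>M\<^esub>b\<in>B. c b \<odot>\<^bsub>M\<^esub> h b)" if "linear_on f"
      using that cl[of x] IH(1) insert.prems[of x] by (simp add: linear_on_def)
    ultimately show ?case
      using IH cl insert.hyps add_closed by simp
  qed
  show "(\<Oplus>\<^bsub>M\<^esub>b\<in>B. c b \<odot>\<^bsub>M\<^esub> h b) \<in> V"
    by (rule conjunct1[OF main])
  show "linear_on f \<Longrightarrow> f (\<Oplus>\<^bsub>M\<^esub>b\<in>B. c b \<odot>\<^bsub>M\<^esub> h b) = (\<Sum>b\<in>B. c b * f (h b))"
    by (rule mp[OF conjunct2[OF main]])
qed

lemma linear_on_expand:
  assumes f: "linear_on f" and v: "v \<in> V"
  shows "f v = (\<Sum>s\<in>S. \<psi> s v * f (e s))"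
proof -
  have "v = (\<Oplus>\<^bsub>M\<^esub>s\<in>S. \<psi> s v \<odot>\<^bsub>M\<^esub> e s)"
  proof (rule coord_inj[OF v])
    fix t assume t: "t \<in> S"
    then have "\<psi> t (\<Oplus>\<^bsub>M\<^esub>s\<in>S. \<psi> s v \<odot>\<^bsub>M\<^esub> e s) = (\<Sum>s\<in>S. \<psi> s v * \<psi> t (e s))"
      by (intro linear_on_combination finite_index vec_closed linear_on_coord)
    also have "\<dots> = (\<Sum>s\<in>S. if t = s then \<psi> t v else 0)"
      using t by (intro sum.cong) (auto simp: coord_vec)
    finally show "\<psi> t v = \<psi> t (\<Oplus>\<^bsub>M\<^esub>s\<in>S. \<psi> s v \<odot>\<^bsub>M\<^esub> e s)"
      using t finite_index by simp
  qed (rule combination_closed[OF finite_index vec_closed])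
  then have "f v = f (\<Oplus>\<^bsub>M\<^esub>s\<in>S. \<psi> s v \<odot>\<^bsub>M\<^esub> e s)" by simp
  also have "\<dots> = (\<Sum>s\<in>S. \<psi> s v * f (e s))"
    by (intro linear_on_combination finite_index vec_closed f)
  finally show ?thesis .
qed

text \<open>Expansions in \<open>M\<close> become systems of linear equations over the field, because the
  coordinates separate points.\<close>

lemma is_expansion_iff:
  assumes "finite B" "B \<subseteq> V" "v \<in> V"
  shows "is_expansion M B c v \<longleftrightarrow> c \<in> extensional B \<and> (\<forall>s\<in>S. \<psi> s v = (\<Sum>b\<in>B. c b * \<psi> s b))"
proof -
  have "(\<Oplus>\<^bsub>M\<^esub>b\<in>B. c b \<odot>\<^bsub>M\<^esub> b) \<in> V"
    using assms by (intro combination_closed) auto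
  moreover have "\<psi> s (\<Oplus>\<^bsub>M\<^esub>b\<in>B. c b \<odot>\<^bsub>M\<^esub> b) = (\<Sum>b\<in>B. c b * \<psi> s b)" if "s \<in> S" for s
    using assms that by (intro linear_on_combination linear_on_coord) auto
  ultimately have "v = (\<Oplus>\<^bsub>M\<^esub>b\<in>B. c b \<odot>\<^bsub>M\<^esub> b) \<longleftrightarrow> (\<forall>s\<in>S. \<psi> s v = (\<Sum>b\<in>B. c b * \<psi> s b))"
    using coord_inj[OF assms(3)] by auto
  then show ?thesis by (simp only: is_expansion_def)
qed

lemma is_finite_basis_vec: "is_finite_basis M V (e ` S)"
proof -
  have inj: "inj_on e S"
  proof (rule inj_onI)
    fix s t assume st: "s \<in> S" "t \<in> S" "e s = e t"
    then show "s = t" using coord_vec[of s s] coord_vec[of s t] by (auto split: if_splits)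
  qed
  have sub: "e ` S \<subseteq> V" using vec_closed by blast
  have coeff: "(\<Sum>b\<in>e ` S. c b * \<psi> s b) = c (e s)" if "s \<in> S" for c :: "'v \<Rightarrow> 'a" and s
  proof -
    have "(\<Sum>b\<in>e ` S. c b * \<psi> s b) = (\<Sum>t\<in>S. c (e t) * \<psi> s (e t))"
      by (simp add: sum.reindex[OF inj])
    also have "\<dots> = (\<Sum>t\<in>S. if s = t then c (e s) else 0)"
      using that by (intro sum.cong) (auto simp: coord_vec)
    finally show ?thesis using that finite_index by simp
  qed
  have "\<exists>!c. is_expansion M (e ` S) c v" if v: "v \<in> V" for v
  proof
    let ?c = "restrict (\<lambda>b. \<psi> (inv_into S e b) v) (e ` S)"
    show "is_expansion M (e ` S) ?c v"
      using v by (simp add: is_expansion_iff finite_index sub coeff inv_into_f_f[OF inj])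
    fix c assume "is_expansion M (e ` S) c v"
    then have "c \<in> extensional (e ` S)" "\<forall>s\<in>S. \<psi> s v = c (e s)"
      using v by (simp_all add: is_expansion_iff finite_index sub coeff)
    then show "c = ?c"
      by (intro extensionalityI[of _ "e ` S"]) (auto simp: inv_into_f_f[OF inj])
  qed
  then show ?thesis
    using finite_index sub by (simp add: is_finite_basis_def)
qed

lemma coordinates_expansion:
  assumes "is_finite_basis M V B" "v \<in> V"
  shows "is_expansion M B (coordinates M B v) v"
proof -
  have "\<exists>!c. is_expansion M B c v" using assms(1)[unfolded is_finite_basis_def] assms(2) by fast
  then show ?thesis unfolding coordinates_def by (rule theI')
qed

lemma coordinates_unique:
  assumes "is_finite_basis M V B" "v \<in> V" "is_expansion M B c v"
  shows "coordinates M B v = c"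
proof -
  have "\<exists>!c. is_expansion M B c v" using assms(1)[unfolded is_finite_basis_def] assms(2) by fast
  then show ?thesis 
    unfolding coordinates_def using assms(3) by (simp only: the1_equality)
qed

lemma linear_on_coordinates:
  assumes B: "is_finite_basis M V B" and b: "b \<in> B"
  shows "linear_on (\<lambda>v. coordinates M B v b)"
proof -
  let ?c = "coordinates M B"
  have fin: "finite B" "B \<subseteq> V" using B by (auto simp: is_finite_basis_def)
  note iff = is_expansion_iff[OF fin]
  have ex: "\<forall>s\<in>S. \<psi> s v = (\<Sum>b\<in>B. ?c v b * \<psi> s b)" if "v \<in> V" for v
    using coordinates_expansion[OF B that] that by (simp add: iff)
  have "?c (u \<oplus>\<^bsub>M\<^esub> v) = restrict (\<lambda>b. ?c u b + ?c v b) B" if "u \<in> V" "v \<in> V" for u v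
    using that ex[OF that(1)] ex[OF that(2)] by (intro coordinates_unique[OF B])
      (simp_all add: iff add_closed coord_add distrib_right sum.distrib)
  moreover have "?c (k \<odot>\<^bsub>M\<^esub> v) = restrict (\<lambda>b. k * ?c v b) B" if "v \<in> V" for k v
    using that ex[OF that] by (intro coordinates_unique[OF B])
      (simp_all add: iff smult_closed coord_smult sum_distrib_left mult.assoc)
  ultimately show ?thesis
    using b by (simp add: linear_on_def)
qed

text \<open>Independence of the trace from the basis. For any finite basis \<open>B\<close> with coordinate
  functionals \<open>c\<close>, expand \<open>c (f b) b\<close>, which is linear in the inner argument \<open>b\<close>, along the
  vectors \<open>e s\<close>; after exchanging the two sums, the sum over \<open>B\<close> is the expansion of
  \<open>f (e s)\<close> in \<open>B\<close>, read off by the functional \<open>\<psi> s\<close>.\<close>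

theorem trace_on_eq:
  assumes closed: "\<And>v. v \<in> V \<Longrightarrow> f v \<in> V"
    and add: "\<And>u v. u \<in> V \<Longrightarrow> v \<in> V \<Longrightarrow> f (u \<oplus>\<^bsub>M\<^esub> v) = f u \<oplus>\<^bsub>M\<^esub> f v"
    and smult: "\<And>c v. v \<in> V \<Longrightarrow> f (c \<odot>\<^bsub>M\<^esub> v) = c \<odot>\<^bsub>M\<^esub> f v"
  shows "trace_on M V f = (\<Sum>s\<in>S. \<psi> s (f (e s)))"
proof -
  define B where "B = (SOME B. is_finite_basis M V B)"
  have B: "is_finite_basis M V B"
    unfolding B_def by (rule someI, rule is_finite_basis_vec)
  then have fin: "finite B" "B \<subseteq> V" by (auto simp: is_finite_basis_def)
  let ?c = "coordinates M B"
  have "?c (f b) b = (\<Sum>s\<in>S. \<psi> s b * ?c (f (e s)) b)" if b: "b \<in> B" for b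
  proof -
    have "linear_on (\<lambda>v. ?c (f v) b)"
      by (rule linear_on_comp[OF linear_on_coordinates[OF B b] closed add smult])
    then show ?thesis using b fin by (intro linear_on_expand) auto
  qed
  then have "trace_on M V f = (\<Sum>b\<in>B. \<Sum>s\<in>S. \<psi> s b * ?c (f (e s)) b)"
    by (simp add: trace_on_def Let_def B_def[symmetric])
  also have "\<dots> = (\<Sum>s\<in>S. \<Sum>b\<in>B. ?c (f (e s)) b * \<psi> s b)"
    by (subst sum.swap) (simp add: mult.commute)
  also have "\<dots> = (\<Sum>s\<in>S. \<psi> s (f (e s)))"
  proof (rule sum.cong)
    fix s assume s: "s \<in> S"
    then have v: "f (e s) \<in> V" by (intro closed vec_closed)
    show "(\<Sum>b\<in>B. ?c (f (e s)) b * \<psi> s b) = \<psi> s (f (e s))"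
      using coordinates_expansion[OF B v] s by (simp add: is_expansion_iff[OF fin v])
  qed simp
  finally show ?thesis .
qed

end

section \<open>Noncommutative polynomials\<close>

text \<open>Additive statements need only be checked on monomials. The monomials are restricted to
  the keys of \<open>p\<close>, so that hypotheses on the support of \<open>p\<close> remain available for them.\<close>

lemma poly_mapping_keys_induct [case_names zero single add]:
  fixes p :: "'w \<Rightarrow>\<^sub>0 'a::comm_monoid_add"
  assumes "P 0" and "\<And>w c. w \<in> Poly_Mapping.keys p \<Longrightarrow> P (Poly_Mapping.single w c)"
    and "\<And>q r. P q \<Longrightarrow> P r \<Longrightarrow> P (q + r)"
  shows "P p"
proof -
  have "p = (\<Sum>w\<in>Poly_Mapping.keys p. Poly_Mapping.single w (Poly_Mapping.lookup p w))"
    by (rule poly_mapping_eqI)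
      (auto simp: lookup_sum lookup_single when_def in_keys_iff)
  moreover have "P (\<Sum>w\<in>K. Poly_Mapping.single w (Poly_Mapping.lookup p w))"
    if "finite K" "K \<subseteq> Poly_Mapping.keys p" for K
    using that by (induction K rule: finite_induct) (auto intro: assms)
  ultimately show ?thesis
    by (metis finite_keys order_refl)
qed

lemma single_word_mult:
  "Poly_Mapping.single u c * Poly_Mapping.single v d
    = Poly_Mapping.single (u @ v) (c * d :: 'a::field)"
  by (simp add: mult_single plus_list_def)

text \<open>A listing of a finite set is a word that contains each of its elements exactly once.
  In a quotient in which the letters of \<open>S\<close> commute, all listings of \<open>S\<close> become the same
  monomial, and this functional reads off its coefficient. It vanishes identically when \<open>S\<close>
  is infinite.\<close>

definition listing_coeff :: "'x set \<Rightarrow> ('x list \<Rightarrow>\<^sub>0 'a::field) \<Rightarrow> 'a" where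
  "listing_coeff S p = (\<Sum>w\<in>permutations_of_set S. Poly_Mapping.lookup p w)"

lemma listing_coeff_zero [simp]: "listing_coeff S 0 = 0"
  by (simp add: listing_coeff_def)

lemma listing_coeff_add: "listing_coeff S (p + q) = listing_coeff S p + listing_coeff S q"
  by (simp add: listing_coeff_def lookup_add sum.distrib)

lemma listing_coeff_diff: "listing_coeff S (p - q) = listing_coeff S p - listing_coeff S q"
  by (simp add: listing_coeff_def lookup_minus sum_subtractf)

lemma listing_coeff_single:
  "listing_coeff S (Poly_Mapping.single w c) = (if w \<in> permutations_of_set S then c else 0)"
  by (simp add: listing_coeff_def lookup_single when_def)

text \<open>A listing of \<open>S\<close> that begins with \<open>u\<close> continues with a listing of the remaining
  elements.\<close>

lemma listing_coeff_mult_left: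
  "listing_coeff S (Poly_Mapping.single u c * q)
    = (if distinct u \<and> set u \<subseteq> S then c * listing_coeff (S - set u) q else 0)"
proof (induction q rule: poly_mapping_keys_induct)
  case (single w d)
  have "u @ w \<in> permutations_of_set S \<longleftrightarrow>
      distinct u \<and> set u \<subseteq> S \<and> w \<in> permutations_of_set (S - set u)"
    by (auto simp: permutations_of_set_def)
  then show ?case by (simp add: single_word_mult listing_coeff_single)
qed (simp_all add: distrib_left listing_coeff_add)

lemma listing_coeff_mult_right:
  "listing_coeff S (q * Poly_Mapping.single u c)
    = (if distinct u \<and> set u \<subseteq> S then listing_coeff (S - set u) q * c else 0)"
proof (induction q rule: poly_mapping_keys_induct)
  case (single w d)
  have "w @ u \<in> permutations_of_set S \<longleftrightarrow>
      distinct u \<and> set u \<subseteq> S \<and> w \<in> permutations_of_set (S - set u)"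
    by (auto simp: permutations_of_set_def)
  then show ?case by (simp add: single_word_mult listing_coeff_single)
qed (simp_all add: distrib_right listing_coeff_add)

lemma listing_coeff_smult: "listing_coeff S (fa_const c * p) = c * listing_coeff S p"
  by (simp add: fa_const_def listing_coeff_mult_left)

section \<open>The square-free partially commutative algebra of a conflict graph\<close>

text \<open>Two letters either annihilate each other (in both orders; in particular every letter
  has square zero) or commute. A commutation relation may be present with either sign, which
  lets a generating set name each unordered pair once. For the conflict graph in which edges
  of a cycle conflict when they share a vertex, independent sets are matchings.\<close>

locale independence_algebra =
  fixes X :: "'x set" and conf :: "'x \<Rightarrow> 'x \<Rightarrow> bool" and R :: "('x list \<Rightarrow>\<^sub>0 'a::field) set"
  assumes finite_letters: "finite X"
    and conf_refl: "x \<in> X \<Longrightarrow> conf x x"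
    and conf_sym: "conf x y \<Longrightarrow> conf y x"
    and relation_cases: "p \<in> R \<Longrightarrow> \<exists>x\<in>X. \<exists>y\<in>X.
      conf x y \<and> p = Poly_Mapping.single [x, y] 1 \<or>
      \<not> conf x y \<and> p = Poly_Mapping.single [x, y] 1 - Poly_Mapping.single [y, x] 1"
    and conflict_relation:
      "x \<in> X \<Longrightarrow> y \<in> X \<Longrightarrow> conf x y \<Longrightarrow> Poly_Mapping.single [x, y] 1 \<in> R"
    and commutation_relation: "x \<in> X \<Longrightarrow> y \<in> X \<Longrightarrow> \<not> conf x y \<Longrightarrow>
      Poly_Mapping.single [x, y] 1 - Poly_Mapping.single [y, x] 1 \<in> R \<or>
      Poly_Mapping.single [y, x] 1 - Poly_Mapping.single [x, y] 1 \<in> R"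
begin

abbreviation A :: "('a, 'x list \<Rightarrow>\<^sub>0 'a) module" where "A \<equiv> free_algebra X"

definition I :: "('x list \<Rightarrow>\<^sub>0 'a) set" where "I = Idl\<^bsub>A\<^esub> R"

definition indep :: "'x set \<Rightarrow> bool" where
  "indep S \<longleftrightarrow> S \<subseteq> X \<and> (\<forall>x\<in>S. \<forall>y\<in>S. conf x y \<longrightarrow> x = y)"

lemma finite_indep: "indep S \<Longrightarrow> finite S"
  using finite_letters by (auto simp: indep_def intro: finite_subset)

lemma indep_subset: "indep S \<Longrightarrow> T \<subseteq> S \<Longrightarrow> indep T"
  unfolding indep_def by blast

lemma single_in_A: "set w \<subseteq> X \<Longrightarrow> Poly_Mapping.single w c \<in> carrier A"
  by (simp split: if_splits)

lemma mult_in_A: "p \<in> carrier A \<Longrightarrow> q \<in> carrier A \<Longrightarrow> p * q \<in> carrier A"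
  using monoid.m_closed[OF ring.is_monoid[OF ring_free_algebra[of X]], of p q]
  by (simp only: free_algebra_simps(2))

lemma relations_in_A: "R \<subseteq> carrier A"
proof
  fix p :: "'x list \<Rightarrow>\<^sub>0 'a" assume "p \<in> R"
  then obtain x y where xy: "x \<in> X" "y \<in> X" "Poly_Mapping.keys p \<subseteq> {[x, y], [y, x]}"
    using relation_cases Poly_Mapping.keys_diff by fastforce
  then show "p \<in> carrier A" by auto
qed

lemma ideal_I: "ideal I A"
  unfolding I_def by (rule ring.genideal_ideal[OF ring_free_algebra relations_in_A])

lemma I_zero: "0 \<in> I"
  using additive_subgroup.zero_closed[OF ideal.axioms(1)[OF ideal_I]] by simp

lemma I_add: "p \<in> I \<Longrightarrow> q \<in> I \<Longrightarrow> p + q \<in> I"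
  using additive_subgroup.a_closed[OF ideal.axioms(1)[OF ideal_I]] by simp

lemma I_mult_left: "p \<in> I \<Longrightarrow> a \<in> carrier A \<Longrightarrow> a * p \<in> I"
  using ideal.I_l_closed[OF ideal_I] by simp

lemma I_mult_right: "p \<in> I \<Longrightarrow> a \<in> carrier A \<Longrightarrow> p * a \<in> I"
  using ideal.I_r_closed[OF ideal_I] by simp

lemma I_smult: "p \<in> I \<Longrightarrow> fa_const c * p \<in> I"
  by (intro I_mult_left) (simp_all add: fa_const_def)

lemma I_uminus: "p \<in> I \<Longrightarrow> - p \<in> I"
proof -
  have "fa_const (- 1) * p = - p"
    by (simp add: fa_const_def single_uminus zero_list_def[symmetric])
  then show "p \<in> I \<Longrightarrow> - p \<in> I" using I_smult[of p "- 1"] by simp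
qed

lemma I_relation: "p \<in> R \<Longrightarrow> p \<in> I"
  unfolding I_def using ring.genideal_self[OF ring_free_algebra relations_in_A] by blast

lemma conflict_word_in_I:
  assumes "set u \<subseteq> X" "set v \<subseteq> X" "x \<in> X" "y \<in> X" "conf x y"
  shows "Poly_Mapping.single (u @ x # y # v) c \<in> I"
proof -
  have "Poly_Mapping.single u c * Poly_Mapping.single [x, y] 1 * Poly_Mapping.single v 1 \<in> I"
    using assms by (intro I_mult_left I_mult_right I_relation conflict_relation single_in_A)
  then show ?thesis by (simp add: single_word_mult)
qed

lemma swap_in_I:
  assumes "set u \<subseteq> X" "set v \<subseteq> X" "x \<in> X" "y \<in> X" "\<not> conf x y"
  shows "Poly_Mapping.single (u @ x # y # v) c - Poly_Mapping.single (u @ y # x # v) c \<in> I"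
proof -
  have "Poly_Mapping.single [x, y] 1 - Poly_Mapping.single [y, x] 1 \<in> I"
    using commutation_relation[OF assms(3-5)] I_relation I_uminus minus_diff_eq by metis
  then have "Poly_Mapping.single u c * (Poly_Mapping.single [x, y] 1 - Poly_Mapping.single [y, x] 1)
      * Poly_Mapping.single v 1 \<in> I"
    using assms by (intro I_mult_left I_mult_right single_in_A)
  then show ?thesis by (simp add: single_word_mult left_diff_distrib right_diff_distrib)
qed

lemma I_trans: "p - q \<in> I \<Longrightarrow> q - r \<in> I \<Longrightarrow> p - r \<in> I"
  using I_add[of "p - q" "q - r"] by simp

lemma move_in_I:
  assumes "set a \<subseteq> X" "set b \<subseteq> X" "x \<in> X" "\<And>y. y \<in> set a \<Longrightarrow> \<not> conf x y"
  shows "Poly_Mapping.single (x # a @ b) c - Poly_Mapping.single (a @ x # b) c \<in> I"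
  using assms
proof (induction a arbitrary: b rule: rev_induct)
  case Nil
  then show ?case by (simp add: I_zero)
next
  case (snoc y a)
  have "Poly_Mapping.single (x # a @ y # b) c - Poly_Mapping.single (a @ x # y # b) c \<in> I"
    using snoc.prems by (intro snoc.IH) auto
  moreover have "Poly_Mapping.single (a @ x # y # b) c - Poly_Mapping.single (a @ y # x # b) c \<in> I"
    using snoc.prems by (intro swap_in_I) auto
  ultimately show ?case using I_trans by simp
qed

lemma cons_in_I:
  assumes "x \<in> X" "Poly_Mapping.single u c - Poly_Mapping.single v c \<in> I"
  shows "Poly_Mapping.single (x # u) c - Poly_Mapping.single (x # v) c \<in> I"
proof -
  have "Poly_Mapping.single [x] 1 * (Poly_Mapping.single u c - Poly_Mapping.single v c) \<in> I"
    using assms by (intro I_mult_left single_in_A) simp_all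
  then show ?thesis by (simp add: single_word_mult right_diff_distrib)
qed

text \<open>Bring the first letter of \<open>u\<close> to the front of \<open>v\<close> by commutations, and induct on the
  rest.\<close>

lemma relisting_in_I:
  assumes "indep S" "u \<in> permutations_of_set S" "v \<in> permutations_of_set S"
  shows "Poly_Mapping.single u c - Poly_Mapping.single v c \<in> I"
  using assms
proof (induction u arbitrary: v S)
  case Nil
  then have "v = []" by (simp add: permutations_of_set_def)
  then show ?case by (simp add: I_zero)
next
  case (Cons x u)
  then have "x \<in> set v" by (auto simp: permutations_of_set_def)
  then obtain a b where v: "v = a @ x # b" using split_list by metis
  have S: "S = insert x (set u)" "x \<notin> set u" "distinct u"
    using Cons.prems by (auto simp: permutations_of_set_def)
  have ab: "set (a @ x # b) = S" "distinct (a @ x # b)"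
    using Cons.prems(3) v by (auto simp: permutations_of_set_def)
  have "set (a @ b) = S - {x}" using ab by auto
  also have "\<dots> = set u" using S by auto
  finally have ab_u: "set (a @ b) = set u" .
  have X: "S \<subseteq> X" using Cons.prems(1) by (simp add: indep_def)
  have "Poly_Mapping.single u c - Poly_Mapping.single (a @ b) c \<in> I"
    by (rule Cons.IH[of "set u"])
      (use S ab ab_u indep_subset[OF Cons.prems(1)] in \<open>auto simp: permutations_of_set_def\<close>)
  then have "Poly_Mapping.single (x # u) c - Poly_Mapping.single (x # a @ b) c \<in> I"
    using S X by (intro cons_in_I) auto
  moreover have "Poly_Mapping.single (x # a @ b) c - Poly_Mapping.single (a @ x # b) c \<in> I"
    using ab X Cons.prems(1) by (intro move_in_I) (auto simp: indep_def)
  ultimately show ?case unfolding v by (rule I_trans)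
qed


text \<open>If the tail is already a listing of an independent set, some letter \<open>y\<close> of it
  conflicts with the head \<open>x\<close>; relisting the tail with \<open>y\<close> in front creates a factor \<open>xy\<close>
  that is a relation.\<close>

lemma non_listing_in_I:
  assumes "set w \<subseteq> X" "\<not> (distinct w \<and> indep (set w))"
  shows "Poly_Mapping.single w c \<in> I"
  using assms
proof (induction w arbitrary: c)
  case Nil
  then show ?case by (simp add: indep_def)
next
  case (Cons x w)
  show ?case
  proof (cases "distinct w \<and> indep (set w)")
    case False
    then have "Poly_Mapping.single w c \<in> I" using Cons by simp
    then have "Poly_Mapping.single [x] 1 * Poly_Mapping.single w c \<in> I"
      using Cons.prems by (intro I_mult_left single_in_A) simp_all
    then show ?thesis by (simp add: single_word_mult)
  next
    case True
    obtain y where y: "y \<in> set w" "conf x y \<or> conf y x"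
      using Cons.prems True conf_refl by (auto simp: indep_def)
    then obtain a b where w: "w = a @ y # b" using split_list by metis
    have in_X: "x \<in> X" "y \<in> X" "set a \<subseteq> X" "set b \<subseteq> X" using Cons.prems(1) w by auto
    have "y # a @ b \<in> permutations_of_set (set w)"
      using True w by (auto simp: permutations_of_set_def)
    then have "Poly_Mapping.single w c - Poly_Mapping.single (y # a @ b) c \<in> I"
      using True by (intro relisting_in_I) (auto simp: permutations_of_set_def)
    then have "Poly_Mapping.single (x # w) c - Poly_Mapping.single (x # y # a @ b) c \<in> I"
      by (rule cons_in_I[OF in_X(1)])
    moreover have "Poly_Mapping.single (x # y # a @ b) c \<in> I"
      using conflict_word_in_I[of "[]" "a @ b" x y c] in_X y conf_sym by auto
    ultimately show ?thesis
      using I_add[of "Poly_Mapping.single (x # w) c - Poly_Mapping.single (x # y # a @ b) c"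
          "Poly_Mapping.single (x # y # a @ b) c"] by simp
  qed
qed

definition listing :: "'x set \<Rightarrow> 'x list" where
  "listing S = (SOME w. w \<in> permutations_of_set S)"

lemma listing_permutation:
  assumes "indep S"
  shows "listing S \<in> permutations_of_set S"
proof -
  obtain w where "set w = S" "distinct w"
    using finite_distinct_list[OF finite_indep[OF assms]] by blast
  then have "w \<in> permutations_of_set S" by (simp add: permutations_of_set_def)
  then show ?thesis unfolding listing_def by (rule someI)
qed

lemma finite_indep_sets: "finite {S. indep S}"
  using finite_letters by (auto simp: indep_def intro: finite_subset[of _ "Pow X"])

definition normal_form :: "('x list \<Rightarrow>\<^sub>0 'a) \<Rightarrow> ('x list \<Rightarrow>\<^sub>0 'a)" where
  "normal_form p = (\<Sum>S | indep S. Poly_Mapping.single (listing S) (listing_coeff S p))"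

text \<open>The monomials of independent sets span modulo \<open>I\<close>: a word is either in \<open>I\<close> or
  congruent to the chosen listing of its set of letters.\<close>

lemma diff_normal_form_in_I:
  assumes "p \<in> carrier A"
  shows "p - normal_form p \<in> I"
proof (induction p rule: poly_mapping_keys_induct)
  case zero
  then show ?case by (simp add: normal_form_def I_zero)
next
  case (single w c)
  have w: "set w \<subseteq> X" using single assms by simp
  have coeff: "listing_coeff S (Poly_Mapping.single w c) = (if distinct w \<and> S = set w then c else 0)" for S
    by (auto simp: listing_coeff_single permutations_of_set_def)
  show ?case
  proof (cases "distinct w \<and> indep (set w)")
    case True
    have "normal_form (Poly_Mapping.single w c)
        = (\<Sum>S | indep S. if S = set w then Poly_Mapping.single (listing (set w)) c else 0)"
      unfolding normal_form_def using True by (intro sum.cong) (auto simp: coeff)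
    also have "\<dots> = Poly_Mapping.single (listing (set w)) c"
      using True finite_indep_sets by simp
    finally show ?thesis
      using True listing_permutation relisting_in_I[of "set w" w "listing (set w)" c]
      by (simp add: permutations_of_set_def)
  next
    case False
    have "normal_form (Poly_Mapping.single w c) = 0"
      unfolding normal_form_def using False by (intro sum.neutral) (auto simp: coeff)
    then show ?thesis using False w non_listing_in_I by simp
  qed
next
  case (add q r)
  have "normal_form (q + r) = normal_form q + normal_form r"
    by (simp add: normal_form_def listing_coeff_add single_add sum.distrib)
  then show ?case using I_add[OF add] by (simp add: algebra_simps)
qed

text \<open>The ideal is determined by sandwiching: this set contains \<open>I\<close> because it is an ideal
  containing the relations, and it lies in \<open>I\<close> because its elements have normal form zero.\<close>

definition coeff_kernel :: "('x list \<Rightarrow>\<^sub>0 'a) set" where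
  "coeff_kernel = {p \<in> carrier A. \<forall>S. indep S \<longrightarrow> listing_coeff S p = 0}"

text \<open>Multiplication by a word \<open>u\<close> turns the functional of \<open>S\<close> into a multiple of the
  functional of \<open>S - set u\<close>, which is again independent.\<close>

lemma coeff_kernel_mult:
  assumes "p \<in> coeff_kernel" "a \<in> carrier A"
  shows coeff_kernel_mult_left: "a * p \<in> coeff_kernel" and coeff_kernel_mult_right: "p * a \<in> coeff_kernel"
proof -
  have carrier: "a * p \<in> carrier A" "p * a \<in> carrier A"
    using assms unfolding coeff_kernel_def by (blast intro: mult_in_A)+
  have zero: "listing_coeff S p = 0" if "indep S" for S
    using assms(1) that by (simp add: coeff_kernel_def)
  have "listing_coeff S (a * p) = 0 \<and> listing_coeff S (p * a) = 0" if S: "indep S" for S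
  proof (induction a rule: poly_mapping_keys_induct)
    case (single u c)
    have "listing_coeff (S - set u) p = 0"
      using zero indep_subset[OF S] by blast
    then show ?case by (simp add: listing_coeff_mult_left listing_coeff_mult_right)
  qed (simp_all add: distrib_left distrib_right listing_coeff_add)
  then show "a * p \<in> coeff_kernel" "p * a \<in> coeff_kernel"
    using carrier by (simp_all add: coeff_kernel_def)
qed

lemma ideal_coeff_kernel: "ideal coeff_kernel A"
proof (rule idealI)
  show "ring A" by (rule ring_free_algebra)
  show "subgroup coeff_kernel (add_monoid A)"
  proof
    show "coeff_kernel \<subseteq> carrier (add_monoid A)" by (auto simp: coeff_kernel_def)
    show "x \<otimes>\<^bsub>add_monoid A\<^esub> y \<in> coeff_kernel" if "x \<in> coeff_kernel" "y \<in> coeff_kernel" for x y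
      using that Poly_Mapping.keys_add[of x y] by (fastforce simp: coeff_kernel_def listing_coeff_add)
    show "\<one>\<^bsub>add_monoid A\<^esub> \<in> coeff_kernel" by (simp add: coeff_kernel_def)
    show "inv\<^bsub>add_monoid A\<^esub> x \<in> coeff_kernel" if x: "x \<in> coeff_kernel" for x
    proof -
      have "- x \<in> carrier A" "x \<in> carrier A" using x by (auto simp: coeff_kernel_def)
      then have "inv\<^bsub>add_monoid A\<^esub> x = - x"
        by (intro group.inv_equality[OF abelian_group.a_group[OF ring.is_abelian_group[OF ring_free_algebra]]])
          simp_all
      moreover have "- x \<in> coeff_kernel"
        using x listing_coeff_diff[of _ 0 x] by (simp add: coeff_kernel_def)
      ultimately show ?thesis by simp
    qed
  qed
qed (simp_all add: coeff_kernel_mult_left coeff_kernel_mult_right del: free_algebra_simps(1))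

lemma relations_in_coeff_kernel: "R \<subseteq> coeff_kernel"
proof
  fix p assume p: "p \<in> R"
  obtain x y where xy: "x \<in> X" "y \<in> X" and
    "conf x y \<and> p = Poly_Mapping.single [x, y] 1 \<or>
      \<not> conf x y \<and> p = Poly_Mapping.single [x, y] 1 - Poly_Mapping.single [y, x] 1"
    using relation_cases[OF p] by blast
  then have "listing_coeff S p = 0" if "indep S" for S
    using that by (auto simp: listing_coeff_single listing_coeff_diff permutations_of_set_def indep_def)
  then show "p \<in> coeff_kernel" using p relations_in_A by (auto simp: coeff_kernel_def)
qed

text \<open>The functionals \<open>listing_coeff S\<close>, for independent \<open>S\<close>, are thus well defined and
  jointly injective on the quotient; equivalently, the monomials of independent sets form a
  basis.\<close>

theorem mem_I_iff:
  "p \<in> I \<longleftrightarrow> p \<in> carrier A \<and> (\<forall>S. indep S \<longrightarrow> listing_coeff S p = 0)"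
proof
  assume "p \<in> I"
  then have "p \<in> coeff_kernel"
    unfolding I_def
    using ring.genideal_minimal[OF ring_free_algebra ideal_coeff_kernel relations_in_coeff_kernel] by blast
  then show "p \<in> carrier A \<and> (\<forall>S. indep S \<longrightarrow> listing_coeff S p = 0)"
    by (simp add: coeff_kernel_def)
next
  assume p: "p \<in> carrier A \<and> (\<forall>S. indep S \<longrightarrow> listing_coeff S p = 0)"
  then have "normal_form p = 0" by (simp add: normal_form_def)
  then show "p \<in> I" using diff_normal_form_in_I[of p] p by simp
qed

section \<open>Graded components of the quotient and signed letter permutations\<close>

lemma coset_eq: "I +>\<^bsub>A\<^esub> p = {q. q - p \<in> I}"
proof -
  have "q \<in> I +>\<^bsub>A\<^esub> p" if "q - p \<in> I" for q
    using that by (auto simp: a_r_coset_def' intro!: bexI[of _ "q - p"])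
  then show ?thesis by (auto simp: a_r_coset_def')
qed

lemma coset_eq_iff: "I +>\<^bsub>A\<^esub> p = I +>\<^bsub>A\<^esub> q \<longleftrightarrow> p - q \<in> I"
proof
  assume "I +>\<^bsub>A\<^esub> p = I +>\<^bsub>A\<^esub> q"
  moreover have "p \<in> I +>\<^bsub>A\<^esub> p" by (simp add: coset_eq I_zero)
  ultimately show "p - q \<in> I" by (simp add: coset_eq)
next
  assume pq: "p - q \<in> I"
  then have "q - p \<in> I" using I_uminus by fastforce
  then show "I +>\<^bsub>A\<^esub> p = I +>\<^bsub>A\<^esub> q"
    using pq I_trans by (auto simp: coset_eq)
qed

text \<open>The coset map takes the union over all representatives; the union collapses when \<open>f\<close>
  preserves congruence modulo \<open>I\<close>.\<close>

lemma induced_map_coset: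
  assumes "\<And>p q. p - q \<in> I \<Longrightarrow> f p - f q \<in> I"
  shows "induced_map A I f (I +>\<^bsub>A\<^esub> p) = I +>\<^bsub>A\<^esub> f p"
proof -
  have "I +>\<^bsub>A\<^esub> f q = I +>\<^bsub>A\<^esub> f p" if "q \<in> I +>\<^bsub>A\<^esub> p" for q
    using that assms[of q p] by (simp add: coset_eq_iff) (simp add: coset_eq)
  moreover have "p \<in> I +>\<^bsub>A\<^esub> p" by (simp add: coset_eq I_zero)
  ultimately show ?thesis unfolding induced_map_def by blast
qed

abbreviation Q :: "('a, ('x list \<Rightarrow>\<^sub>0 'a) set) module" where "Q \<equiv> quotient_algebra A I"

lemma abelian_monoid_Q: "abelian_monoid Q"
proof -
  interpret quotient: abelian_monoid "A Quot I"
    using ring.is_abelian_group[OF ideal.quotient_is_ring[OF ideal_I]]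
    by (rule abelian_group.axioms(1))
  have Q: "carrier Q = carrier (A Quot I)" "add Q = add (A Quot I)" "zero Q = zero (A Quot I)"
    by (simp_all add: quotient_algebra_def)
  show ?thesis
    by (rule abelian_monoidI; unfold Q)
      (simp_all add: quotient.add.m_ac)
qed

lemma Q_carrier: "p \<in> carrier A \<Longrightarrow> I +>\<^bsub>A\<^esub> p \<in> carrier Q"
  by (auto simp: quotient_algebra_def FactRing_def A_RCOSETS_def' a_r_coset_def' simp del: free_algebra_simps(1))

lemma Q_zero: "\<zero>\<^bsub>Q\<^esub> = I +>\<^bsub>A\<^esub> 0"
  by (simp add: quotient_algebra_def FactRing_def coset_eq)

lemma Q_add:
  assumes "p \<in> carrier A" "q \<in> carrier A"
  shows "(I +>\<^bsub>A\<^esub> p) \<oplus>\<^bsub>Q\<^esub> (I +>\<^bsub>A\<^esub> q) = I +>\<^bsub>A\<^esub> (p + q)"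
proof -
  have "abelian_subgroup I A"
    by (rule abelian_subgroupI3)
      (rule ideal.axioms(1)[OF ideal_I], rule ring.is_abelian_group[OF ring_free_algebra])
  from abelian_subgroup.a_rcos_sum[OF this assms] show ?thesis
    by (simp add: quotient_algebra_def FactRing_def)
qed

lemma Q_smult: "c \<odot>\<^bsub>Q\<^esub> (I +>\<^bsub>A\<^esub> p) = I +>\<^bsub>A\<^esub> (fa_const c * p)"
proof -
  have "c \<odot>\<^bsub>Q\<^esub> (I +>\<^bsub>A\<^esub> p) = induced_map A I (\<lambda>p. fa_const c * p) (I +>\<^bsub>A\<^esub> p)"
    by (simp add: quotient_algebra_def induced_map_def)
  also have "\<dots> = I +>\<^bsub>A\<^esub> (fa_const c * p)"
    by (rule induced_map_coset) (simp add: right_diff_distrib[symmetric] I_smult)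
  finally show ?thesis .
qed

definition homogeneous :: "nat \<Rightarrow> ('x list \<Rightarrow>\<^sub>0 'a) set" where
  "homogeneous d = {p \<in> carrier A. \<forall>w\<in>Poly_Mapping.keys p. length w = d}"

lemma homogeneous_add: "p \<in> homogeneous d \<Longrightarrow> q \<in> homogeneous d \<Longrightarrow> p + q \<in> homogeneous d"
  using Poly_Mapping.keys_add[of p q] unfolding homogeneous_def free_algebra_simps by blast

lemma lookup_smult: "Poly_Mapping.lookup (fa_const c * p) w = c * Poly_Mapping.lookup p w"
proof (induction p rule: poly_mapping_keys_induct)
  case (single v d)
  then show ?case by (simp add: fa_const_def single_word_mult lookup_single when_def)
qed (simp_all add: lookup_add distrib_left)

lemma homogeneous_smult: "p \<in> homogeneous d \<Longrightarrow> fa_const c * p \<in> homogeneous d"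
  by (auto simp: homogeneous_def in_keys_iff lookup_smult)

lemma homogeneous_single: "set w \<subseteq> X \<Longrightarrow> length w = d \<Longrightarrow> Poly_Mapping.single w c \<in> homogeneous d"
  by (simp add: homogeneous_def)

definition component :: "nat \<Rightarrow> ('x list \<Rightarrow>\<^sub>0 'a) set set" where
  "component d = (\<lambda>p. I +>\<^bsub>A\<^esub> p) ` homogeneous d"

text \<open>For independent \<open>S\<close> the value does not depend on the chosen representative, since the
  functional vanishes on \<open>I\<close>.\<close>

definition coset_coeff :: "'x set \<Rightarrow> ('x list \<Rightarrow>\<^sub>0 'a) set \<Rightarrow> 'a" where
  "coset_coeff S P = listing_coeff S (SOME p. p \<in> P)"

lemma coset_coeff_coset:
  assumes "indep S"
  shows "coset_coeff S (I +>\<^bsub>A\<^esub> p) = listing_coeff S p"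
proof -
  define q where "q = (SOME q. q \<in> I +>\<^bsub>A\<^esub> p)"
  have "p \<in> I +>\<^bsub>A\<^esub> p" by (simp add: coset_eq I_zero)
  then have "q \<in> I +>\<^bsub>A\<^esub> p" unfolding q_def by (rule someI)
  then have "listing_coeff S (q - p) = 0" using assms by (simp add: coset_eq mem_I_iff)
  then show ?thesis by (simp add: coset_coeff_def q_def listing_coeff_diff)
qed

lemma card_listing: "w \<in> permutations_of_set S \<Longrightarrow> length w = card S"
  by (auto simp: permutations_of_set_def distinct_card)

lemma listing_coeff_homogeneous:
  assumes "p \<in> homogeneous d" "card S \<noteq> d"
  shows "listing_coeff S p = 0"
  unfolding listing_coeff_def
proof (rule sum.neutral, rule ballI)
  fix w assume "w \<in> permutations_of_set S"
  then have "w \<notin> Poly_Mapping.keys p" using assms card_listing[of w S] by (auto simp: homogeneous_def)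
  then show "Poly_Mapping.lookup p w = 0" by (simp add: in_keys_iff)
qed

lemma listing_homogeneous: "indep S \<Longrightarrow> Poly_Mapping.single (listing S) c \<in> homogeneous (card S)"
  using listing_permutation[of S] card_listing
  by (intro homogeneous_single) (auto simp: permutations_of_set_def indep_def)

text \<open>A homogeneous element has no listing coefficient at sets of another size, so the
  independent sets of size \<open>d\<close> already separate the points of the component.\<close>

lemma coordinate_space_component:
  "coordinate_space Q (component d) {S. indep S \<and> card S = d} coset_coeff
    (\<lambda>S. I +>\<^bsub>A\<^esub> Poly_Mapping.single (listing S) 1)"
proof (rule coordinate_space.intro)
  show "abelian_monoid Q" by (rule abelian_monoid_Q)
  have carr: "p \<in> carrier A" if "p \<in> homogeneous d" for p using that by (simp add: homogeneous_def)
  show "(\<zero>\<^bsub>Q\<^esub>) \<in> component d"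
    by (auto simp: Q_zero component_def homogeneous_def)
  show "component d \<subseteq> carrier Q"
    using Q_carrier carr by (auto simp: component_def)
  show "u \<oplus>\<^bsub>Q\<^esub> v \<in> component d" if "u \<in> component d" "v \<in> component d" for u v
    using that carr homogeneous_add Q_add by (fastforce simp: component_def)
  show "c \<odot>\<^bsub>Q\<^esub> v \<in> component d" if "v \<in> component d" for c v
    using that homogeneous_smult Q_smult by (fastforce simp: component_def)
  show "coset_coeff S (u \<oplus>\<^bsub>Q\<^esub> v) = coset_coeff S u + coset_coeff S v"
    if "S \<in> {S. indep S \<and> card S = d}" "u \<in> component d" "v \<in> component d" for S u v
    using that carr by (auto simp: component_def Q_add coset_coeff_coset listing_coeff_add simp del: free_algebra_simps(1))
  show "coset_coeff S (c \<odot>\<^bsub>Q\<^esub> v) = c * coset_coeff S v"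
    if "S \<in> {S. indep S \<and> card S = d}" "v \<in> component d" for S c v
    using that by (auto simp: component_def Q_smult coset_coeff_coset listing_coeff_smult)
  show "u = v" if uv: "u \<in> component d" "v \<in> component d"
    and eq: "\<And>S. S \<in> {S. indep S \<and> card S = d} \<Longrightarrow> coset_coeff S u = coset_coeff S v" for u v
  proof -
    obtain p q where p: "p \<in> homogeneous d" "u = I +>\<^bsub>A\<^esub> p" and q: "q \<in> homogeneous d" "v = I +>\<^bsub>A\<^esub> q"
      using uv by (auto simp: component_def)
    have "listing_coeff S p = listing_coeff S q" if "indep S" for S
    proof (cases "card S = d")
      case True
      then show ?thesis using eq[of S] that p q by (simp add: coset_coeff_coset)
    next
      case False
      then show ?thesis using p(1) q(1) by (simp add: listing_coeff_homogeneous)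
    qed
    moreover have "p - q \<in> carrier A"
      using carr[OF p(1)] carr[OF q(1)] Poly_Mapping.keys_diff[of p q] by auto
    ultimately have "p - q \<in> I" by (simp add: mem_I_iff listing_coeff_diff)
    then show ?thesis using p q by (simp add: coset_eq_iff)
  qed
  show "finite {S. indep S \<and> card S = d}"
    by (rule finite_subset[OF _ finite_indep_sets]) blast
  show "I +>\<^bsub>A\<^esub> Poly_Mapping.single (listing S) 1 \<in> component d"
    if "S \<in> {S. indep S \<and> card S = d}" for S
    using that listing_homogeneous by (auto simp: component_def)
  show "coset_coeff S (I +>\<^bsub>A\<^esub> Poly_Mapping.single (listing T) 1) = (if S = T then 1 else 0)"
    if "S \<in> {S. indep S \<and> card S = d}" "T \<in> {S. indep S \<and> card S = d}" for S T
    using that listing_permutation[of T]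
    by (auto simp: coset_coeff_coset listing_coeff_single permutations_of_set_def)
qed

text \<open>An automorphism of the conflict graph, twisted by signs, permutes the basis monomials
  up to sign: \<open>f\<close> sends the monomial of \<open>S\<close> to \<open>\<Prod>x\<in>S. \<epsilon> x\<close> times the monomial of \<open>\<tau> ` S\<close>.
  Only invariant independent sets contribute to the diagonal.\<close>

lemma trace_signed_permutation:
  fixes f :: "('x list \<Rightarrow>\<^sub>0 'a) \<Rightarrow> ('x list \<Rightarrow>\<^sub>0 'a)" and \<tau> :: "'x \<Rightarrow> 'x" and \<epsilon> :: "'x \<Rightarrow> 'a"
  assumes f_add: "\<And>p q. f (p + q) = f p + f q"
    and f_single: "\<And>w c. set w \<subseteq> X \<Longrightarrow>
      f (Poly_Mapping.single w c) = Poly_Mapping.single (map \<tau> w) (prod_list (map \<epsilon> w) * c)"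
    and \<tau>: "bij_betw \<tau> X X"
    and conf: "\<And>x y. x \<in> X \<Longrightarrow> y \<in> X \<Longrightarrow> conf x y \<Longrightarrow> conf (\<tau> x) (\<tau> y)"
  shows "trace_on Q (component d) (induced_map A I f)
    = (\<Sum>S | indep S \<and> card S = d \<and> \<tau> ` S = S. \<Prod>x\<in>S. \<epsilon> x)"
proof -
  have inj: "inj_on \<tau> X" and onto: "\<tau> ` X = X" using \<tau> by (auto simp: bij_betw_def)
  have f_zero: "f 0 = 0" using f_single[of "[]" 0] by simp
  have f_uminus: "f (- p) = - f p" for p
    using f_add[of p "- p"] f_zero by (simp add: minus_unique)
  have f_diff: "f (p - q) = f p - f q" for p q
    using f_add[of p "- q"] f_uminus by simp
  have f_carrier: "f p \<in> carrier A" if p: "p \<in> carrier A" for p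
  proof (induction p rule: poly_mapping_keys_induct)
    case (single w c)
    then have "set w \<subseteq> X" using p by simp
    then show ?case using onto by (subst f_single) (auto intro: single_in_A)
  next
    case (add q r)
    then show ?case using Poly_Mapping.keys_add[of "f q" "f r"] by (auto simp: f_add)
  qed (simp add: f_zero)
  have f_homogeneous: "f p \<in> homogeneous d" if p: "p \<in> homogeneous d" for p
  proof (induction p rule: poly_mapping_keys_induct)
    case (single w c)
    then have "set w \<subseteq> X" "length w = d" using p by (simp_all add: homogeneous_def)
    moreover from this have "set (map \<tau> w) \<subseteq> X" using onto by auto
    ultimately show ?case by (simp add: f_single homogeneous_single)
  qed (simp add: f_zero homogeneous_def, simp add: f_add homogeneous_add)
  have f_smult: "f (fa_const c * p) = fa_const c * f p" if p: "p \<in> carrier A" for c p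
  proof (induction p rule: poly_mapping_keys_induct)
    case (single w b)
    then have "set w \<subseteq> X" using p by simp
    then show ?case by (simp add: fa_const_def single_word_mult f_single mult.left_commute)
  qed (simp_all add: f_zero f_add distrib_left)
  \<comment> \<open>This identity shows both that the action preserves the ideal and what its matrix is.\<close>
  have coeff: "listing_coeff (\<tau> ` S) (f p) = prod \<epsilon> S * listing_coeff S p"
    if S: "S \<subseteq> X" and p: "p \<in> carrier A" for S p
  proof (induction p rule: poly_mapping_keys_induct)
    case (single w c)
    then have w: "set w \<subseteq> X" using p by simp
    have "map \<tau> w \<in> permutations_of_set (\<tau> ` S) \<longleftrightarrow> w \<in> permutations_of_set S"
      using inj_on_image_eq_iff[OF inj w S] inj_on_subset[OF inj w]
      by (auto simp: permutations_of_set_def distinct_map)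
    moreover have "prod_list (map \<epsilon> w) = prod \<epsilon> S" if "w \<in> permutations_of_set S"
      using that by (auto simp: permutations_of_set_def prod.distinct_set_conv_list)
    ultimately show ?case using w by (simp add: f_single listing_coeff_single)
  qed (simp_all add: f_zero f_add listing_coeff_add distrib_left)
  have indep_preimage: "\<exists>S. T = \<tau> ` S \<and> indep S" if T: "indep T" for T
  proof -
    obtain S where S: "S \<subseteq> X" "T = \<tau> ` S"
      using T onto by (metis indep_def subset_imageE)
    have "x = y" if "x \<in> S" "y \<in> S" "conf x y" for x y
    proof -
      have "\<tau> x = \<tau> y" using that S T conf[of x y] by (auto simp: indep_def)
      then show ?thesis using that S inj by (auto dest: inj_onD)
    qed
    then have "indep S" using S(1) by (auto simp: indep_def)
    then show ?thesis using S by blast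
  qed
  have f_I: "f p \<in> I" if p: "p \<in> I" for p
  proof -
    have "listing_coeff T (f p) = 0" if T: "indep T" for T
      using indep_preimage[OF T] p by (auto simp: coeff mem_I_iff indep_def)
    then show ?thesis using p f_carrier[of p] by (simp add: mem_I_iff)
  qed
  have ind: "induced_map A I f (I +>\<^bsub>A\<^esub> p) = I +>\<^bsub>A\<^esub> f p" for p
    by (rule induced_map_coset) (use f_I f_diff in metis)
  interpret coordinate_space Q "component d" "{S. indep S \<and> card S = d}" coset_coeff
      "\<lambda>S. I +>\<^bsub>A\<^esub> Poly_Mapping.single (listing S) 1"
    by (rule coordinate_space_component)
  have homogeneous_carrier: "p \<in> carrier A" if "p \<in> homogeneous d" for p
    using that by (simp add: homogeneous_def)
  have "trace_on Q (component d) (induced_map A I f)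
      = (\<Sum>S | indep S \<and> card S = d. coset_coeff S (induced_map A I f (I +>\<^bsub>A\<^esub> Poly_Mapping.single (listing S) 1)))"
  proof (rule trace_on_eq)
    show "induced_map A I f v \<in> component d" if "v \<in> component d" for v
      using that f_homogeneous by (auto simp: component_def ind)
    show "induced_map A I f (u \<oplus>\<^bsub>Q\<^esub> v) = induced_map A I f u \<oplus>\<^bsub>Q\<^esub> induced_map A I f v"
      if "u \<in> component d" "v \<in> component d" for u v
      using that homogeneous_carrier f_carrier
      by (auto simp: component_def ind Q_add f_add simp del: free_algebra_simps(1))
    show "induced_map A I f (c \<odot>\<^bsub>Q\<^esub> v) = c \<odot>\<^bsub>Q\<^esub> induced_map A I f v"
      if "v \<in> component d" for c v
      using that homogeneous_carrier f_smult
      by (auto simp: component_def ind Q_smult simp del: free_algebra_simps(1))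
  qed
  also have "\<dots> = (\<Sum>S | indep S \<and> card S = d. if \<tau> ` S = S then prod \<epsilon> S else 0)"
  proof (rule sum.cong)
    fix S assume "S \<in> {S. indep S \<and> card S = d}"
    then have S: "indep S" "S \<subseteq> X" by (auto simp: indep_def)
    have l: "set (listing S) = S" "distinct (listing S)"
      using listing_permutation[OF S(1)] by (auto simp: permutations_of_set_def)
    have "\<tau> ` S = set (map \<tau> (listing S))" using l by simp
    moreover have "distinct (map \<tau> (listing S))"
      using l inj_on_subset[OF inj S(2)] by (simp add: distinct_map)
    moreover have "prod_list (map \<epsilon> (listing S)) = prod \<epsilon> S"
      using prod.distinct_set_conv_list[OF l(2), of \<epsilon>] l(1) by simp
    ultimately show "coset_coeff S (induced_map A I f (I +>\<^bsub>A\<^esub> Poly_Mapping.single (listing S) 1))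
        = (if \<tau> ` S = S then prod \<epsilon> S else 0)"
      using S l by (simp add: ind coset_coeff_coset f_single listing_coeff_single permutations_of_set_def)
  qed simp
  also have "\<dots> = (\<Sum>S | indep S \<and> card S = d \<and> \<tau> ` S = S. prod \<epsilon> S)"
    using finite_index by (simp add: sum.inter_filter[symmetric] conj_assoc)
  finally show ?thesis .
qed

end

section \<open>Permutations of the vertices of the cycle\<close>

text \<open>The defining sum ranges over the support of its argument, which can shrink when
  coefficients cancel; all three sums are therefore extended to a common support.\<close>

lemma free_action_add:
  "free_action \<sigma> (p + q) = free_action \<sigma> p + (free_action \<sigma> q :: _ \<Rightarrow>\<^sub>0 'a::field)"
proof -
  let ?h = "\<lambda>w. prod_list (map (\<lambda>(i, j). gen (\<sigma> i) (\<sigma> j)) w) :: _ \<Rightarrow>\<^sub>0 'a"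
  let ?K = "Poly_Mapping.keys p \<union> Poly_Mapping.keys q"
  have extend: "free_action \<sigma> r = (\<Sum>w\<in>?K. fa_const (Poly_Mapping.lookup r w) * ?h w)"
    if "Poly_Mapping.keys r \<subseteq> ?K" for r
    unfolding free_action_def using that
    by (intro sum.mono_neutral_left) (auto simp: in_keys_iff fa_const_def)
  show ?thesis
    using Poly_Mapping.keys_add[of p q]
    by (simp add: extend lookup_add fa_const_def single_add distrib_right sum.distrib)
qed

text \<open>With letters written as ordered pairs, a vertex permutation sends \<open>x\<^sub>i\<^sub>j\<close> to the
  letter on the image edge, with the sign \<open>letter_sign\<close> that records whether the two end
  points had to be exchanged.\<close>

definition letter_image :: "(nat \<Rightarrow> nat) \<Rightarrow> nat \<times> nat \<Rightarrow> nat \<times> nat" where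
  "letter_image \<sigma> x = (min (\<sigma> (fst x)) (\<sigma> (snd x)), max (\<sigma> (fst x)) (\<sigma> (snd x)))"

definition letter_sign :: "(nat \<Rightarrow> nat) \<Rightarrow> nat \<times> nat \<Rightarrow> 'a::field" where
  "letter_sign \<sigma> x = (if \<sigma> (fst x) < \<sigma> (snd x) then 1 else - 1)"

lemma single_empty_word: "Poly_Mapping.single [] 1 = 1"
  by (simp only: zero_list_def[symmetric] single_one)

lemma free_action_single:
  "free_action \<sigma> (Poly_Mapping.single w c)
    = Poly_Mapping.single (map (letter_image \<sigma>) w) (prod_list (map (letter_sign \<sigma>) w) * c :: 'a::field)"
proof -
  have "prod_list (map (\<lambda>(i, j). gen (\<sigma> i) (\<sigma> j)) w)
      = Poly_Mapping.single (map (letter_image \<sigma>) w) (prod_list (map (letter_sign \<sigma>) w) :: 'a)"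
  proof (induction w)
    case Nil
    then show ?case by (simp add: single_empty_word)
  next
    case (Cons x w)
    have "(case x of (i, j) \<Rightarrow> gen (\<sigma> i) (\<sigma> j))
        = Poly_Mapping.single [letter_image \<sigma> x] (letter_sign \<sigma> x :: 'a)"
      by (cases x) (auto simp: gen_def letter_image_def letter_sign_def single_uminus min_def max_def)
    then show ?case using Cons by (simp add: single_word_mult)
  qed
  then show ?thesis
    by (cases "c = 0") (simp_all add: free_action_def fa_const_def single_word_mult mult.commute)
qed

definition shares_vertex :: "nat \<times> nat \<Rightarrow> nat \<times> nat \<Rightarrow> bool" where
  "shares_vertex x y \<longleftrightarrow> {fst x, snd x} \<inter> {fst y, snd y} \<noteq> {}"

lemma shares_vertex_letter_image:
  "shares_vertex x y \<Longrightarrow> shares_vertex (letter_image \<sigma> x) (letter_image \<sigma> y)"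
  by (auto simp: shares_vertex_def letter_image_def min_def max_def split: if_splits)

abbreviation edge :: "nat \<Rightarrow> nat \<times> nat" where
  "edge m \<equiv> (m, Suc m)"

lemma cycle_letters_cases:
  assumes "x \<in> cycle_letters n"
  obtains (path) m where "1 \<le> m" "m \<le> n - 1" "x = edge m" | (closing) "x = (1, n)"
  using assms by (auto simp: cycle_letters_def)

lemma gen_mult_gen:
  "i < j \<Longrightarrow> k < l \<Longrightarrow> gen i j * gen k l = Poly_Mapping.single [(i, j), (k, l)] (1 :: 'a::field)"
  by (simp add: gen_def single_word_mult)

text \<open>The families of relations name each pair of edges in a definite order: of two disjoint
  path edges the one with the smaller index comes first, and the closing edge comes last.\<close>

lemma independence_algebra_cycle:
  assumes n: "n \<ge> 4"
  shows "independence_algebra (cycle_letters n) shares_vertex (fk_relations n :: (_ \<Rightarrow>\<^sub>0 'a::field) set)"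
proof
  let ?R = "fk_relations n :: ((nat \<times> nat) list \<Rightarrow>\<^sub>0 'a) set"
  let ?mono = "\<lambda>x y. Poly_Mapping.single [x, y] (1 :: 'a)"
  have "cycle_letters n \<subseteq> {..n} \<times> {..n}" using n by (auto simp: cycle_letters_def)
  then show "finite (cycle_letters n)" by (rule finite_subset) simp
  show "shares_vertex x x" for x by (simp add: shares_vertex_def)
  show "shares_vertex y x" if "shares_vertex x y" for x y
    using that by (auto simp: shares_vertex_def)
  show "\<exists>x\<in>cycle_letters n. \<exists>y\<in>cycle_letters n.
      shares_vertex x y \<and> p = ?mono x y \<or> \<not> shares_vertex x y \<and> p = ?mono x y - ?mono y x"
    if p: "p \<in> ?R" for p
  proof -
    have path: "edge m \<in> cycle_letters n" if "1 \<le> m" "m \<le> n - 1" for m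
      using that by (auto simp: cycle_letters_def)
    have last: "(n - 1, n) \<in> cycle_letters n" using n path[of "n - 1"] by simp
    have closing: "(1, n) \<in> cycle_letters n" by (simp add: cycle_letters_def)
    have conflict: ?thesis
      if "p = ?mono x y" "x \<in> cycle_letters n" "y \<in> cycle_letters n" "shares_vertex x y" for x y
      using that by blast
    have commute: ?thesis
      if "p = ?mono x y - ?mono y x" "x \<in> cycle_letters n" "y \<in> cycle_letters n" "\<not> shares_vertex x y" for x y
      using that by blast
    from p consider
        m where "p = gen m (m + 1) * gen m (m + 1)" "1 \<le> m" "m \<le> n - 1"
      | "p = gen 1 n * gen 1 n"
      | m where "p = gen m (m + 1) * gen (m + 1) (m + 2)" "1 \<le> m" "m \<le> n - 2"
      | m where "p = gen (m + 1) (m + 2) * gen m (m + 1)" "1 \<le> m" "m \<le> n - 2"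
      | "p = gen (n - 1) n * gen 1 n" | "p = gen 1 n * gen (n - 1) n"
      | "p = gen 1 2 * gen 1 n" | "p = gen 1 n * gen 1 2"
      | m l where "p = gen m (m + 1) * gen l (l + 1) - gen l (l + 1) * gen m (m + 1)"
          "1 \<le> m" "m \<le> l - 2" "3 \<le> l" "l \<le> n - 1"
      | m where "p = gen m (m + 1) * gen 1 n - gen 1 n * gen m (m + 1)" "2 \<le> m" "m \<le> n - 2"
      unfolding fk_relations_def by blast
    then show ?thesis
    proof cases
      case (1 m)
      then show ?thesis
        using path[of m] by (intro conflict[of "edge m" "edge m"]) (simp_all add: gen_mult_gen shares_vertex_def)
    next
      case 2
      then show ?thesis
        using closing n by (intro conflict[of "(1, n)" "(1, n)"]) (simp_all add: gen_mult_gen shares_vertex_def)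
    next
      case (3 m)
      then show ?thesis
        using path[of m] path[of "m + 1"] n
        by (intro conflict[of "edge m" "edge (m + 1)"]) (simp_all add: gen_mult_gen shares_vertex_def)
    next
      case (4 m)
      then show ?thesis
        using path[of m] path[of "m + 1"] n
        by (intro conflict[of "edge (m + 1)" "edge m"]) (simp_all add: gen_mult_gen shares_vertex_def)
    next
      case 5
      then show ?thesis
        using closing last n by (intro conflict[of "(n - 1, n)" "(1, n)"]) (simp_all add: gen_mult_gen shares_vertex_def)
    next
      case 6
      then show ?thesis
        using closing last n by (intro conflict[of "(1, n)" "(n - 1, n)"]) (simp_all add: gen_mult_gen shares_vertex_def)
    next
      case 7
      then show ?thesis
        using closing path[of 1] n by (intro conflict[of "(1, 2)" "(1, n)"]) (simp_all add: gen_mult_gen shares_vertex_def numeral_2_eq_2)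
    next
      case 8
      then show ?thesis
        using closing path[of 1] n by (intro conflict[of "(1, n)" "(1, 2)"]) (simp_all add: gen_mult_gen shares_vertex_def numeral_2_eq_2)
    next
      case (9 m l)
      moreover from this have "m + 2 \<le> l" by linarith
      ultimately show ?thesis
        using path[of m] path[of l] n
        by (intro commute[of "edge m" "edge l"]) (simp_all add: gen_mult_gen shares_vertex_def)
    next
      case (10 m)
      then show ?thesis
        using path[of m] closing n
        by (intro commute[of "edge m" "(1, n)"]) (simp_all add: gen_mult_gen shares_vertex_def)
    qed
  qed
  note rel = fk_relations_def Un_iff mem_Collect_eq
  show "?mono x y \<in> ?R"
    if x: "x \<in> cycle_letters n" and y: "y \<in> cycle_letters n" and xy: "shares_vertex x y" for x y
    using x
  proof (cases rule: cycle_letters_cases)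
    case (path a)
    note a = this
    show ?thesis using y
    proof (cases rule: cycle_letters_cases)
      case (path b)
      have "a = b \<or> b = a + 1 \<or> a = b + 1" using xy a path by (auto simp: shares_vertex_def)
      then consider "a = b" | "b = a + 1" | "a = b + 1" by blast
      then show ?thesis
      proof cases
        case 1
        then have "?mono x y = gen a (a + 1) * gen a (a + 1)" using a path by (simp add: gen_mult_gen)
        then show ?thesis unfolding rel using a by blast
      next
        case 2
        then have "?mono x y = gen a (a + 1) * gen (a + 1) (a + 2)" "a \<le> n - 2"
          using a path by (simp_all add: gen_mult_gen)
        then show ?thesis unfolding rel using a by blast
      next
        case 3
        then have "?mono x y = gen (b + 1) (b + 2) * gen b (b + 1)" "b \<le> n - 2"
          using a path by (simp_all add: gen_mult_gen)
        then show ?thesis unfolding rel using path by blast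
      qed
    next
      case closing
      have "a = 1 \<or> a = n - 1" using xy a closing n by (auto simp: shares_vertex_def)
      then have "?mono x y = gen (n - 1) n * gen 1 n \<or> ?mono x y = gen 1 2 * gen 1 n"
        using a closing n by (auto simp: gen_mult_gen numeral_2_eq_2)
      then show ?thesis unfolding rel by blast
    qed
  next
    case closing
    note a = this
    show ?thesis using y
    proof (cases rule: cycle_letters_cases)
      case (path b)
      have "b = 1 \<or> b = n - 1" using xy a path n by (auto simp: shares_vertex_def)
      then have "?mono x y = gen 1 n * gen (n - 1) n \<or> ?mono x y = gen 1 n * gen 1 2"
        using a path n by (auto simp: gen_mult_gen numeral_2_eq_2)
      then show ?thesis unfolding rel by blast
    next
      case closing
      then have "?mono x y = gen 1 n * gen 1 n" using a n by (simp add: gen_mult_gen)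
      then show ?thesis unfolding rel by blast
    qed
  qed
  have far: "?mono (edge m) (edge l) - ?mono (edge l) (edge m) \<in> ?R"
    if "1 \<le> m" "m + 2 \<le> l" "l \<le> n - 1" for m l
  proof -
    have "?mono (edge m) (edge l) - ?mono (edge l) (edge m)
        = gen m (m + 1) * gen l (l + 1) - gen l (l + 1) * gen m (m + 1)"
      by (simp add: gen_mult_gen)
    moreover have "1 \<le> m" "m \<le> l - 2" "3 \<le> l" "l \<le> n - 1" using that by auto
    ultimately show ?thesis unfolding rel by blast
  qed
  have far_closing: "?mono (edge m) (1, n) - ?mono (1, n) (edge m) \<in> ?R"
    if "2 \<le> m" "m \<le> n - 2" for m
  proof -
    have "?mono (edge m) (1, n) - ?mono (1, n) (edge m)
        = gen m (m + 1) * gen 1 n - gen 1 n * gen m (m + 1)"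
      using n by (simp add: gen_mult_gen)
    then show ?thesis unfolding rel using that by blast
  qed
  show "?mono x y - ?mono y x \<in> ?R \<or> ?mono y x - ?mono x y \<in> ?R"
    if x: "x \<in> cycle_letters n" and y: "y \<in> cycle_letters n" and xy: "\<not> shares_vertex x y" for x y
    using x
  proof (cases rule: cycle_letters_cases)
    case (path a)
    note a = this
    show ?thesis using y
    proof (cases rule: cycle_letters_cases)
      case (path b)
      have "a + 2 \<le> b \<or> b + 2 \<le> a" using xy a path by (auto simp: shares_vertex_def)
      then show ?thesis using far[of a b] far[of b a] a path by auto
    next
      case closing
      have "2 \<le> a" "a \<le> n - 2" using xy a closing n by (auto simp: shares_vertex_def)
      then show ?thesis using far_closing[of a] a closing by simp
    qed
  next
    case closing
    note a = this
    show ?thesis using y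
    proof (cases rule: cycle_letters_cases)
      case (path b)
      have "2 \<le> b" "b \<le> n - 2" using xy a path n by (auto simp: shares_vertex_def)
      then show ?thesis using far_closing[of b] a path by simp
    next
      case closing
      then show ?thesis using xy a by (simp add: shares_vertex_def)
    qed
  qed
qed


lemma trace_fk_component:
  fixes n d :: nat
  assumes n: "n \<ge> 4" and \<tau>: "bij_betw (letter_image \<sigma>) (cycle_letters n) (cycle_letters n)"
  shows "trace_on (fk_cycle n) (fk_component n d) (fk_action n \<sigma>)
    = (\<Sum>S | S \<subseteq> cycle_letters n \<and> (\<forall>x\<in>S. \<forall>y\<in>S. shares_vertex x y \<longrightarrow> x = y)
          \<and> card S = d \<and> letter_image \<sigma> ` S = S. \<Prod>x\<in>S. (letter_sign \<sigma> x :: 'a::field))"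
proof -
  interpret independence_algebra "cycle_letters n" shares_vertex "fk_relations n :: (_ \<Rightarrow>\<^sub>0 'a) set"
    by (rule independence_algebra_cycle[OF n])
  have ideal: "fk_ideal n = I" by (simp add: fk_ideal_def fk_free_def I_def)
  have "fk_component n d = component d"
    by (auto simp: fk_component_def component_def homogeneous_def fk_free_def ideal)
  moreover have "fk_cycle n = Q" by (simp add: fk_cycle_def fk_free_def ideal)
  moreover have "fk_action n \<sigma> = induced_map A I (free_action \<sigma>)"
    by (simp add: fk_action_def fk_free_def ideal)
  moreover have "trace_on Q (component d) (induced_map A I (free_action \<sigma>))
    = (\<Sum>S | indep S \<and> card S = d \<and> letter_image \<sigma> ` S = S. \<Prod>x\<in>S. letter_sign \<sigma> x)"
    by (rule trace_signed_permutation[OF free_action_add free_action_single \<tau> shares_vertex_letter_image])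
  ultimately show ?thesis by (simp add: indep_def conj_assoc)
qed

section \<open>Sparse subsets of an interval\<close>

definition sparse :: "nat set \<Rightarrow> bool" where
  "sparse T \<longleftrightarrow> (\<forall>m\<in>T. Suc m \<notin> T)"

text \<open>A sparse subset of \<open>{1..N}\<close> that contains \<open>N\<close> avoids \<open>N - 1\<close>; splitting by whether it
  contains \<open>N\<close> gives Pascal's rule. Truncated subtraction makes the right-hand side vanish
  for \<open>k > N\<close>.\<close>

lemma card_sparse_subsets:
  "card {T. T \<subseteq> {1..N} \<and> sparse T \<and> card T = k} = (N + 1 - k) choose k"
proof (induction N arbitrary: k rule: less_induct)
  case (less N)
  let ?F = "\<lambda>N k. {T. T \<subseteq> {1..N} \<and> sparse T \<and> card T = k}"
  have fin: "finite (?F N k)" for N k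
    by (rule finite_subset[of _ "Pow {1..N}"]) auto
  consider "k = 0" | "N = 0" "k > 0" | "N = 1" "k > 0" | M j where "N = Suc (Suc M)" "k = Suc j"
    by (metis One_nat_def not0_implies_Suc zero_less_iff_neq_zero)
  then show ?case
  proof cases
    case 1
    have "T = {}" if "T \<in> ?F N 0" for T
      using that finite_subset[of T "{1..N}"] by auto
    then have "?F N k = {{}}" using 1 by (auto simp: sparse_def)
    then show ?thesis using 1 by simp
  next
    case 2
    then have "?F N k = {}" by auto
    then show ?thesis using 2 by (simp add: binomial_eq_0)
  next
    case 3
    have "?F N k = (if k = 1 then {{1}} else {})"
      using 3 by (auto simp: sparse_def subset_singleton_iff)
    then show ?thesis using 3 by (auto simp: binomial_eq_0)
  next
    case 4
    have notin: "N \<notin> T" if "T \<subseteq> {1..M}" for T using that 4 by auto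
    have "?F N k = ?F (Suc M) k \<union> insert N ` ?F M j"
    proof
      show "?F N k \<subseteq> ?F (Suc M) k \<union> insert N ` ?F M j"
      proof
        fix T assume T: "T \<in> ?F N k"
        then have finT: "finite T" using finite_subset[of T "{1..N}"] by auto
        show "T \<in> ?F (Suc M) k \<union> insert N ` ?F M j"
        proof (cases "N \<in> T")
          case True
          then have "Suc M \<notin> T" using T 4 by (auto simp: sparse_def)
          then have "T - {N} \<subseteq> {1..M}"
            using T 4 by (auto simp: subset_iff) (metis Suc_leI le_SucE le_antisym not_less)
          moreover have "card (T - {N}) = j" using T True finT 4 by simp
          ultimately have "T - {N} \<in> ?F M j" using T by (auto simp: sparse_def)
          moreover have "T = insert N (T - {N})" using True by auto
          ultimately show ?thesis by blast
        next
          case False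
          then have "T \<subseteq> {1..Suc M}"
            using T 4 by (auto simp: subset_iff) (metis le_SucE)
          then show ?thesis using T by auto
        qed
      qed
      show "?F (Suc M) k \<union> insert N ` ?F M j \<subseteq> ?F N k"
      proof
        fix T assume "T \<in> ?F (Suc M) k \<union> insert N ` ?F M j"
        then show "T \<in> ?F N k"
        proof
          assume "T \<in> insert N ` ?F M j"
          then obtain U where U: "T = insert N U" "U \<in> ?F M j" by blast
          then have "finite U" using finite_subset[of U "{1..M}"] by auto
          then show ?thesis using U 4 notin[of U] by (auto simp: sparse_def subset_iff)
        qed (use 4 in auto)
      qed
    qed
    moreover have "?F (Suc M) k \<inter> insert N ` ?F M j = {}" using 4 by auto
    moreover have "inj_on (insert N) (?F M j)"
      by (rule inj_onI) (use notin in \<open>auto simp: insert_ident\<close>)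
    ultimately have "card (?F N k) = card (?F (Suc M) k) + card (?F M j)"
      by (simp add: card_Un_disjoint fin card_image)
    also have "\<dots> = ((Suc M + 1 - k) choose k) + ((M + 1 - j) choose j)"
      using 4 by (simp only: less.IH[of "Suc M"] less.IH[of M] lessI less_SucI)
    also have "\<dots> = (N + 1 - k) choose k"
    proof (cases "j \<le> M + 1")
      case True
      then have "N + 1 - k = Suc (M + 1 - j)" "Suc M + 1 - k = M + 1 - j" using 4 by auto
      then show ?thesis using 4 by simp
    next
      case False
      then show ?thesis using 4 by (simp add: binomial_eq_0)
    qed
    finally show ?thesis .
  qed
qed

section \<open>The reflection through two opposite vertices\<close>

lemma rotation_eq:
  assumes "1 \<le> i" "i \<le> n"
  shows "rotation n i = (if i = n then 1 else i + 1)"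
proof -
  let ?cs = "[1..<n + 1]"
  have "map (cycle_of_list ?cs) ?cs = rotate1 ?cs"
    using cyclic_rotation[of ?cs 1] by simp
  moreover have "rotate1 ?cs ! (i - 1) = (if i = n then 1 else i + 1)"
    using assms by (auto simp: nth_rotate1 nth_upt mod_if simp del: upt_Suc)
  moreover have "map (cycle_of_list ?cs) ?cs ! (i - 1) = rotation n i"
    using assms by (simp add: rotation_def del: upt_Suc)
  ultimately show ?thesis by simp
qed

lemma reflection_rotation_eq:
  assumes "1 \<le> i" "i \<le> n"
  shows "(reflection n \<circ> rotation n) i = (if i = n then n else n - i)"
  using assms by (auto simp: rotation_eq reflection_def)

text \<open>For \<open>n = 2 h\<close> the permutation \<open>sr\<close> is the reflection of the cycle through the opposite
  vertices \<open>h\<close> and \<open>n\<close>. It exchanges the two edges at \<open>n\<close> without a sign, and it sends the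
  edge \<open>m\<close> to the edge \<open>n - 1 - m\<close> with sign \<open>-1\<close> for all other \<open>m\<close>; since \<open>n - 1\<close> is odd,
  it fixes no edge.\<close>

context
  fixes n h :: nat
  assumes h: "n = 2 * h" "h \<ge> 2"
begin

abbreviation \<tau> :: "nat \<times> nat \<Rightarrow> nat \<times> nat" where
  "\<tau> \<equiv> letter_image (reflection n \<circ> rotation n)"

abbreviation mirror :: "nat \<Rightarrow> nat" where
  "mirror m \<equiv> n - Suc m"

lemma letter_image_edge:
  assumes "1 \<le> m" "m \<le> n - 2"
  shows "\<tau> (edge m) = edge (mirror m)"
    and "letter_sign (reflection n \<circ> rotation n) (edge m) = (- 1 :: 'a::field)"
proof -
  have "(reflection n \<circ> rotation n) m = n - m" "(reflection n \<circ> rotation n) (m + 1) = n - (m + 1)"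
    using assms h reflection_rotation_eq[of m n] reflection_rotation_eq[of "m + 1" n] by auto
  then show "\<tau> (edge m) = edge (mirror m)"
    "letter_sign (reflection n \<circ> rotation n) (edge m) = (- 1 :: 'a::field)"
    using assms by (simp_all add: letter_image_def letter_sign_def del: comp_apply)
qed

lemma letter_image_ends: "\<tau> (1, n) = (n - 1, n)" "\<tau> (n - 1, n) = (1, n)"
proof -
  have "(reflection n \<circ> rotation n) 1 = n - 1" "(reflection n \<circ> rotation n) n = n"
    "(reflection n \<circ> rotation n) (n - 1) = 1"
    using h reflection_rotation_eq[of 1 n] reflection_rotation_eq[of n n]
      reflection_rotation_eq[of "n - 1" n] by auto
  then show "\<tau> (1, n) = (n - 1, n)" "\<tau> (n - 1, n) = (1, n)"
    using h by (simp_all add: letter_image_def del: comp_apply)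
qed

lemma cycle_letters_even_cases:
  assumes "x \<in> cycle_letters n"
  obtains (inner) m where "1 \<le> m" "m \<le> n - 2" "x = edge m"
    | (last) "x = (n - 1, n)" | (closing) "x = (1, n)"
  using assms
proof (cases rule: cycle_letters_cases)
  case (path m)
  then show ?thesis using that(1)[of m] that(2) h by (cases "m = n - 1") auto
qed (use that in blast)

lemma edge_in_cycle_letters: "1 \<le> m \<Longrightarrow> m \<le> n - 1 \<Longrightarrow> edge m \<in> cycle_letters n"
  by (auto simp: cycle_letters_def)

lemma bij_letter_image: "bij_betw \<tau> (cycle_letters n) (cycle_letters n)"
proof -
  have closing: "(1, n) \<in> cycle_letters n" by (simp add: cycle_letters_def)
  have last: "(n - 1, n) \<in> cycle_letters n" using edge_in_cycle_letters[of "n - 1"] h by simp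
  have "\<tau> x \<in> cycle_letters n \<and> \<tau> (\<tau> x) = x" if "x \<in> cycle_letters n" for x
    using that
  proof (cases rule: cycle_letters_even_cases)
    case (inner m)
    then have "1 \<le> mirror m" "mirror m \<le> n - 2" "mirror (mirror m) = m" using h by auto
    then show ?thesis
      using inner edge_in_cycle_letters[of "mirror m"] by (simp add: letter_image_edge)
  qed (use closing last letter_image_ends in simp_all)
  then show ?thesis by (intro bij_betw_byWitness[of _ \<tau>]) auto
qed

definition fixed_matchings :: "(nat \<times> nat) set set" where
  "fixed_matchings = {S. S \<subseteq> cycle_letters n \<and> (\<forall>x\<in>S. \<forall>y\<in>S. shares_vertex x y \<longrightarrow> x = y) \<and> \<tau> ` S = S}"

text \<open>The invariant matching determined by its edges on the path from vertex 1 to vertex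
  \<open>h - 1\<close>.\<close>

definition mirrored_edges :: "nat set \<Rightarrow> (nat \<times> nat) set" where
  "mirrored_edges T = edge ` (T \<union> mirror ` T)"

text \<open>The edges \<open>m \<le> h - 2\<close> and their mirror images \<open>\<ge> h + 1\<close> are too far apart to meet, so
  a sparse half gives a matching. Its edges come in pairs, each of which carries the sign
  \<open>(-1) * (-1) = 1\<close>.\<close>

lemma mirrored_edges:
  assumes T: "T \<subseteq> {1..h - 2}" "sparse T"
  shows mirrored_edges_fixed: "mirrored_edges T \<in> fixed_matchings"
    and card_mirrored_edges: "card (mirrored_edges T) = 2 * card T"
    and sign_mirrored_edges:
      "(\<Prod>x\<in>mirrored_edges T. letter_sign (reflection n \<circ> rotation n) x) = (1 :: 'a::field)"
proof -
  define U where "U = T \<union> mirror ` T"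
  have edges: "mirrored_edges T = edge ` U" by (simp add: mirrored_edges_def U_def)
  have T_bounds: "1 \<le> m \<and> m + 2 \<le> h" if "m \<in> T" for m
    using subsetD[OF T(1) that] by auto
  have U_bounds: "1 \<le> m \<and> m \<le> n - 2" if "m \<in> U" for m
  proof -
    from that consider "m \<in> T" | a where "a \<in> T" "m = mirror a" unfolding U_def by blast
    then show ?thesis
    proof cases
      case 1
      then show ?thesis using T_bounds[of m] h by linarith
    next
      case (2 a)
      then show ?thesis using T_bounds[of a] h by linarith
    qed
  qed
  have mm: "mirror (mirror m) = m" if "m \<in> T" for m using T_bounds[OF that] h by auto
  have mirror_U: "mirror ` U = U"
  proof -
    have "mirror ` mirror ` T = T" using mm by (simp add: image_image)
    then show ?thesis unfolding U_def by (simp only: image_Un Un_commute)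
  qed
  have sparse_U: "Suc m \<notin> U" if "m \<in> U" for m
  proof
    assume "Suc m \<in> U"
    with that consider "m \<in> T" "Suc m \<in> T" | a where "m \<in> T" "a \<in> T" "Suc m = mirror a"
      | a where "a \<in> T" "Suc m \<in> T" "m = mirror a" | a b where "a \<in> T" "b \<in> T" "m = mirror a" "Suc m = mirror b"
      unfolding U_def by blast
    then show False
    proof cases
      case 1
      then show False using T(2) by (auto simp: sparse_def)
    next
      case (2 a)
      then show False using T_bounds[of m] T_bounds[of a] h by auto
    next
      case (3 a)
      then show False using T_bounds[of "Suc m"] T_bounds[of a] h by auto
    next
      case (4 a b)
      then have "a = Suc b" using T_bounds[of a] T_bounds[of b] h by auto
      then show False using T(2) 4 by (auto simp: sparse_def)
    qed
  qed
  have "\<tau> ` mirrored_edges T = mirrored_edges T"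
  proof -
    have "\<tau> ` mirrored_edges T = (\<lambda>m. \<tau> (edge m)) ` U" by (simp only: edges image_image)
    also have "\<dots> = (\<lambda>m. edge (mirror m)) ` U"
      using U_bounds by (intro image_cong) (auto simp: letter_image_edge)
    also have "\<dots> = edge ` mirror ` U" by (simp only: image_image)
    finally show ?thesis by (simp only: mirror_U edges)
  qed
  moreover have "mirrored_edges T \<subseteq> cycle_letters n"
    unfolding edges
  proof (rule image_subsetI)
    fix m assume "m \<in> U"
    then show "edge m \<in> cycle_letters n" using U_bounds[of m] by (intro edge_in_cycle_letters) auto
  qed
  moreover have "x = y" if "x \<in> mirrored_edges T" "y \<in> mirrored_edges T" "shares_vertex x y" for x y
  proof -
    from that(1) obtain a where a: "x = edge a" "a \<in> U"
      unfolding edges by (rule imageE)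
    from that(2) obtain b where b: "y = edge b" "b \<in> U"
      unfolding edges by (rule imageE)
    show ?thesis
      using a b that(3) sparse_U[of a] sparse_U[of b] by (auto simp: shares_vertex_def)
  qed
  ultimately show "mirrored_edges T \<in> fixed_matchings" by (simp add: fixed_matchings_def)
  have finT: "finite T" using T(1) finite_subset by blast
  have "m \<noteq> mirror a" if "m \<in> T" "a \<in> T" for m a
    using T_bounds[OF that(1)] T_bounds[OF that(2)] h by linarith
  then have disjoint: "T \<inter> mirror ` T = {}" by blast
  have inj_mirror: "inj_on mirror T" using mm by (rule inj_on_inverseI)
  have inj_edge: "inj_on edge U" by (rule inj_onI) simp
  have "card (mirrored_edges T) = card U"
    unfolding edges by (rule card_image[OF inj_edge])
  also have "\<dots> = 2 * card T"
    using finT disjoint unfolding U_def by (simp add: card_Un_disjoint card_image[OF inj_mirror])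
  finally show card: "card (mirrored_edges T) = 2 * card T" .
  have "(\<Prod>x\<in>mirrored_edges T. letter_sign (reflection n \<circ> rotation n) x)
      = (\<Prod>x\<in>mirrored_edges T. (- 1 :: 'a))"
    using U_bounds letter_image_edge(2) by (intro prod.cong) (auto simp: edges)
  then show "(\<Prod>x\<in>mirrored_edges T. letter_sign (reflection n \<circ> rotation n) x) = (1 :: 'a)"
    by (simp add: card power_mult)
qed

text \<open>The two edges at the vertex \<open>n\<close> are exchanged and share that vertex, so an invariant
  matching contains neither; the same holds for the edges \<open>h - 1\<close> and \<open>h\<close> at the opposite
  fixed vertex \<open>h\<close>. What remains are two paths that the reflection exchanges.\<close>

lemma fixed_matching_mirrored:
  assumes "S \<in> fixed_matchings"
  obtains T where "T \<subseteq> {1..h - 2}" "sparse T" "S = mirrored_edges T"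
proof
  have sub: "S \<subseteq> cycle_letters n" and matching: "\<And>x y. x \<in> S \<Longrightarrow> y \<in> S \<Longrightarrow> shares_vertex x y \<Longrightarrow> x = y"
    and invariant: "\<tau> ` S = S"
    using assms by (auto simp: fixed_matchings_def)
  let ?T = "{m \<in> {1..h - 2}. edge m \<in> S}"
  have maps: "\<tau> x \<in> S" if "x \<in> S" for x using invariant that by blast
  have "(1, n) \<notin> S \<or> (n - 1, n) \<notin> S"
    using matching[of "(1, n)" "(n - 1, n)"] h by (auto simp: shares_vertex_def)
  then have ends: "(1, n) \<notin> S" "(n - 1, n) \<notin> S"
    using maps[of "(1, n)"] maps[of "(n - 1, n)"] unfolding letter_image_ends by blast+
  have mirror_S: "edge (mirror m) \<in> S" if "edge m \<in> S" "1 \<le> m" "m \<le> n - 2" for m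
    using maps[OF that(1)] letter_image_edge(1)[OF that(2,3)] by simp
  have neighbour: "edge (Suc m) \<notin> S" if "edge m \<in> S" for m
    using matching[of "edge m" "edge (Suc m)"] that by (auto simp: shares_vertex_def)
  have centre: "edge (h - 1) \<notin> S" "edge h \<notin> S"
  proof -
    have "mirror (h - 1) = h" "mirror h = h - 1" "Suc (h - 1) = h" using h by auto
    then show "edge (h - 1) \<notin> S" "edge h \<notin> S"
      using mirror_S[of "h - 1"] mirror_S[of h] neighbour[of "h - 1"] h by auto
  qed
  show "?T \<subseteq> {1..h - 2}" by blast
  show "sparse ?T" using neighbour by (auto simp: sparse_def)
  show "S = mirrored_edges ?T"
  proof
    show "S \<subseteq> mirrored_edges ?T"
    proof
      fix x assume x: "x \<in> S"
      then have "x \<in> cycle_letters n" using sub by blast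
      then show "x \<in> mirrored_edges ?T"
      proof (cases rule: cycle_letters_even_cases)
        case (inner m)
        have "m \<noteq> h - 1" "m \<noteq> h" using centre x inner by auto
        then consider "m \<le> h - 2" | "h + 1 \<le> m" by linarith
        then show ?thesis
        proof cases
          case 1
          then have "m \<in> ?T" using inner x by simp
          then show ?thesis using inner by (auto simp: mirrored_edges_def)
        next
          case 2
          then have "mirror m \<in> ?T" "m = mirror (mirror m)"
            using inner x mirror_S[of m] h by auto
          then have "m \<in> mirror ` ?T" by (rule rev_image_eqI)
          then show ?thesis using inner by (auto simp: mirrored_edges_def)
        qed
      qed (use ends x in auto)
    qed
    show "mirrored_edges ?T \<subseteq> S"
    proof
      fix x assume "x \<in> mirrored_edges ?T"
      then obtain m where "m \<in> ?T" "x = edge m \<or> x = edge (mirror m)"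
        unfolding mirrored_edges_def by blast
      moreover from this(1) have "edge m \<in> S" "1 \<le> m" "m \<le> n - 2" using h by auto
      ultimately show "x \<in> S" using mirror_S[of m] by auto
    qed
  qed
qed

lemma inj_mirrored_edges: "inj_on mirrored_edges {T. T \<subseteq> {1..h - 2}}"
proof (rule inj_on_inverseI)
  fix T assume T: "T \<in> {T. T \<subseteq> {1..h - 2}}"
  have "m \<in> T" if m: "m \<in> {1..h - 2}" and e: "edge m \<in> mirrored_edges T" for m
  proof -
    have "m \<notin> mirror ` T"
    proof
      assume "m \<in> mirror ` T"
      then obtain a where "a \<in> T" "m = mirror a" by blast
      moreover from this have "a \<in> {1..h - 2}" using T by blast
      ultimately show False using m h by auto
    qed
    then show ?thesis using e by (auto simp: mirrored_edges_def)
  qed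
  then show "{m \<in> {1..h - 2}. edge m \<in> mirrored_edges T} = T"
    using T by (auto simp: mirrored_edges_def)
qed

lemma trace_fixed_matchings:
  "trace_on (fk_cycle n) (fk_component n d) (fk_action n (reflection n \<circ> rotation n))
    = (if even d then of_nat ((h - 1 - d div 2) choose (d div 2)) else (0 :: 'a::field))"
proof -
  let ?F = "{S \<in> fixed_matchings. card S = d}"
  let ?T = "{T. T \<subseteq> {1..h - 2} \<and> sparse T \<and> 2 * card T = d}"
  have "trace_on (fk_cycle n) (fk_component n d) (fk_action n (reflection n \<circ> rotation n))
      = (\<Sum>S\<in>?F. \<Prod>x\<in>S. (letter_sign (reflection n \<circ> rotation n) x :: 'a))"
  proof -
    have "?F = {S. S \<subseteq> cycle_letters n \<and> (\<forall>x\<in>S. \<forall>y\<in>S. shares_vertex x y \<longrightarrow> x = y)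
          \<and> card S = d \<and> \<tau> ` S = S}"
      by (auto simp: fixed_matchings_def)
    then show ?thesis
      using h trace_fk_component[OF _ bij_letter_image, of d] by (simp only:) simp
  qed
  also have "\<dots> = (\<Sum>S\<in>?F. 1)"
  proof (rule sum.cong)
    fix S assume "S \<in> ?F"
    then have "S \<in> fixed_matchings" by simp
    then obtain T where "T \<subseteq> {1..h - 2}" "sparse T" "S = mirrored_edges T"
      by (rule fixed_matching_mirrored)
    then show "(\<Prod>x\<in>S. letter_sign (reflection n \<circ> rotation n) x) = (1 :: 'a)"
      by (simp only: sign_mirrored_edges)
  qed simp
  also have "\<dots> = of_nat (card ?F)" by simp
  also have "?F = mirrored_edges ` ?T"
  proof
    show "?F \<subseteq> mirrored_edges ` ?T"
    proof
      fix S assume S: "S \<in> ?F"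
      then have "S \<in> fixed_matchings" by simp
      then obtain T where "T \<subseteq> {1..h - 2}" "sparse T" "S = mirrored_edges T"
        by (rule fixed_matching_mirrored)
      then show "S \<in> mirrored_edges ` ?T" using S by (auto simp: card_mirrored_edges)
    qed
    show "mirrored_edges ` ?T \<subseteq> ?F"
      by (auto simp: card_mirrored_edges mirrored_edges_fixed)
  qed
  also have "card (mirrored_edges ` ?T) = card ?T"
    by (rule card_image, rule inj_on_subset[OF inj_mirrored_edges]) blast
  also have "card ?T = (if even d then (h - 1 - d div 2) choose (d div 2) else 0)"
  proof (cases "even d")
    case True
    then have "?T = {T. T \<subseteq> {1..h - 2} \<and> sparse T \<and> card T = d div 2}" by auto
    then show ?thesis
      using True h card_sparse_subsets[of "h - 2" "d div 2"] by (simp add: Suc_diff_Suc numeral_2_eq_2)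
  next
    case False
    then have "?T = {}" by auto
    then show ?thesis using False by simp
  qed
  finally show ?thesis by (cases "even d") (simp_all only: if_True if_False simp_thms of_nat_0)
qed

end

lemma pcompose_monom: "monom c k \<circ>\<^sub>p q = smult c (q ^ k)"
  for q :: "'a::comm_semiring_1 poly"
  by (induction k) (simp_all add: monom_0 monom_Suc pcompose_pCons mult_smult_right)

theorem lemma2p22:
  fixes n :: nat
  assumes "n \<ge> 4" and "even n"
  shows "(graded_trace n (reflection n \<circ> rotation n) :: 'a::field fps)
           = (\<Sum>k = 0..(n div 2 - 1) div 2. of_nat ((n div 2 - 1 - k) choose k) * fps_X ^ (2 * k))
       \<and> (graded_trace n (reflection n \<circ> rotation n) :: 'a::field fps)
           = fps_of_poly (q_fibonacci (n div 2 - 1) \<circ>\<^sub>p monom 1 2)"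
proof -
  define h where "h = n div 2"
  have h: "n = 2 * h" "h \<ge> 2" using assms by (auto simp: h_def)
  let ?K = "(h - 1) div 2"
  let ?S = "\<Sum>k = 0..?K. of_nat ((h - 1 - k) choose k) * fps_X ^ (2 * k) :: 'a fps"
  have "graded_trace n (reflection n \<circ> rotation n) = ?S"
  proof (rule fps_ext)
    fix d
    have "fps_nth ?S d = (\<Sum>k = 0..?K. if d = 2 * k then of_nat ((h - 1 - k) choose k) else 0)"
      by (simp add: fps_sum_nth fps_X_power_nth if_distrib cong: if_cong)
    also have "\<dots> = (if even d then of_nat ((h - 1 - d div 2) choose (d div 2)) else 0)"
    proof (cases "even d \<and> d div 2 \<le> ?K")
      case True
      then have "(\<Sum>k = 0..?K. if d = 2 * k then of_nat ((h - 1 - k) choose k) else 0 :: 'a)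
          = (\<Sum>k = 0..?K. if k = d div 2 then of_nat ((h - 1 - d div 2) choose (d div 2)) else 0)"
        by (intro sum.cong) auto
      then show ?thesis using True by simp
    next
      case False
      then have "(\<Sum>k = 0..?K. if d = 2 * k then of_nat ((h - 1 - k) choose k) else 0 :: 'a) = 0"
        by (intro sum.neutral) auto
      \<comment> \<open>Beyond the summation range the binomial coefficient has a lower index above its upper index.\<close>
      moreover have "(h - 1 - d div 2) choose (d div 2) = 0" if "even d"
        using False that by (intro binomial_eq_0) auto
      ultimately show ?thesis by (simp del: binomial_eq_0_iff)
    qed
    finally show "fps_nth (graded_trace n (reflection n \<circ> rotation n)) d = fps_nth ?S d"
      by (simp add: graded_trace_def trace_fixed_matchings[OF h])
  qed
  moreover have "fps_of_poly (q_fibonacci (h - 1) \<circ>\<^sub>p monom 1 2) = ?S"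
  proof -
    have "monom (of_nat c) k \<circ>\<^sub>p monom 1 2 = (smult (of_nat c) (monom 1 (2 * k)) :: 'a poly)" for c k
      by (simp only: pcompose_monom monom_power power_one)
    then show ?thesis
      by (simp add: q_fibonacci_def pcompose_sum fps_of_poly_sum fps_of_poly_smult fps_of_poly_monom fps_of_nat)
  qed
  ultimately show ?thesis by (simp add: h_def)
qed

end
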